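(* Given $\gamma>0$ and $q>2$, there is a constant $\Lambda=\Lambda(\gamma,q)$ such that if $A\subset\mathbb{Z}$ is a finite set with $|A|=N$ and $|A\cdot A|<KN$, then $$\lambda_q(A)<K^{\Lambda}N^{\gamma}.$$
   Context: $|\cdot|$ denotes cardinality, $A\cdot A=\{ab: a,b\in A\}$, and $K$ is a real number. $\mathbb{T}=\mathbb{R}/\mathbb{Z}$ carries normalized Lebesgue measure. For a finite set $A\subset\mathbb{Z}$ and $q>2$, the $\Lambda_q$-constant of $A$ is $$\lambda_q(A)=\max\Big\|\sum_{n\in A}c_n e^{2\pi i n\theta}\Big\|_{L^q(\mathbb{T})},$$ the maximum being over all sequences $(c_n)_{n\in A}$ with $\big(\sum_{n\in A} c_n^2\big)^{1/2}\le 1$.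
   Formalization: Assumes in addition K ≥ 2 when |A·A| = |A| > 1 (only A = {0,a}, {a,−a}, {0,a,−a}); as stated the claim fails for A = {−1,1}, q = 4, γ = 1/10 as K tends to 1. *)

theory Defs
  imports "HOL-Analysis.Analysis" "HOL-Library.Set_Algebras"
begin

definition trig_sum :: "int set \<Rightarrow> (int \<Rightarrow> real) \<Rightarrow> real \<Rightarrow> complex" where
  "trig_sum A c \<theta> = (\<Sum>n\<in>A. of_real (c n) * exp (2 * of_real pi * \<i> * of_int n * of_real \<theta>))"

text \<open>A function on the circle is represented by a 1-periodic function on the reals, so that
  normalized Lebesgue measure becomes Lebesgue measure on the unit interval.\<close>

definition circle_norm :: "real \<Rightarrow> (real \<Rightarrow> complex) \<Rightarrow> real" where
  "circle_norm q f = (LINT \<theta>:{0..1}|lborel. cmod (f \<theta>) powr q) powr (1 / q)"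

text \<open>The coefficients are real, as the normalisation by the sum of \<open>c\<^sub>n\<^sup>2\<close> indicates. The
  supremum is a maximum: see \<open>lambda_const_attained\<close>.\<close>

definition lambda_const :: "real \<Rightarrow> int set \<Rightarrow> real" where
  "lambda_const q A =
     Sup {circle_norm q (trig_sum A c) | c. sqrt (\<Sum>n\<in>A. (c n)\<^sup>2) \<le> 1}"

lemma lambda_const_attained:
  assumes A: "finite A" and q: "q > 2"
  shows "\<exists>c. sqrt (\<Sum>n\<in>A. (c n)\<^sup>2) \<le> 1 \<and> lambda_const q A = circle_norm q (trig_sum A c) \<and>
           (\<forall>d. sqrt (\<Sum>n\<in>A. (d n)\<^sup>2) \<le> 1 \<longrightarrow> circle_norm q (trig_sum A d) \<le> lambda_const q A)"
proof -
  define B where "B = (PiE UNIV (\<lambda>n. if n \<in> A then {-1..1} else {0}) :: (int \<Rightarrow> real) set)"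
  define S where "S = B \<inter> {c. sqrt (\<Sum>n\<in>A. (c n)\<^sup>2) \<le> 1}"
  define F where "F = (\<lambda>c. circle_norm q (trig_sum A c))"
  have "compactin (product_topology (\<lambda>n. euclidean) UNIV) B"
    unfolding B_def by (subst compactin_PiE) auto
  then have cB: "compact B"
    by (simp add: euclidean_product_topology)
  have "closed {c :: int \<Rightarrow> real. sqrt (\<Sum>n\<in>A. (c n)\<^sup>2) \<le> 1}"
    by (intro closed_Collect_le continuous_intros continuous_on_product_coordinates)
  with cB have cS: "compact S"
    unfolding S_def by (rule compact_Int_closed)
  have joint: "continuous_on (UNIV \<times> cbox 0 (1::real)) (\<lambda>(c, \<theta>). cmod (trig_sum A c \<theta>) powr q)"
    unfolding trig_sum_def split_beta
    by (rule continuous_on_powr', intro continuous_intros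
        continuous_on_compose2[OF continuous_on_product_coordinates])
       (use q in \<open>auto intro!: continuous_intros\<close>)
  have jS: "continuous_on (UNIV :: (int \<Rightarrow> real) set)
      (\<lambda>c. integral (cbox 0 1) (\<lambda>\<theta>. cmod (trig_sum A c \<theta>) powr q))"
    by (rule integral_continuous_on_param[OF joint])
  have c1: "continuous_on {0..1} (\<lambda>\<theta>. cmod (trig_sum A c \<theta>) powr q)" for c
    using q unfolding trig_sum_def
    by (intro continuous_on_powr' continuous_intros) auto
  have F_eq: "F c = (integral (cbox 0 1) (\<lambda>\<theta>. cmod (trig_sum A c \<theta>) powr q)) powr (1 / q)" for c
    unfolding F_def circle_norm_def
    by (subst set_borel_integral_eq_integral(2)[OF borel_integrable_atLeastAtMost']) (auto intro: c1)
  have "continuous_on S F"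
    unfolding F_eq
    by (intro continuous_on_powr' continuous_intros continuous_on_subset[OF jS])
       (use q in \<open>auto intro!: integral_nonneg integrable_continuous_real c1\<close>)
  moreover have "(\<lambda>n. 0) \<in> S"
    unfolding S_def B_def by auto
  ultimately obtain c where c: "c \<in> S" "\<And>d. d \<in> S \<Longrightarrow> F d \<le> F c"
    using continuous_attains_sup[OF cS] by blast
  have ub: "F d \<le> F c" if "sqrt (\<Sum>n\<in>A. (d n)\<^sup>2) \<le> 1" for d
  proof -
    define d' where "d' = (\<lambda>n. if n \<in> A then d n else 0)"
    have "d n \<in> {-1..1}" if "n \<in> A" for n
    proof -
      have "(d n)\<^sup>2 \<le> (\<Sum>n\<in>A. (d n)\<^sup>2)"
        using A that by (intro member_le_sum) auto
      also have "\<dots> \<le> 1"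
        using \<open>sqrt (\<Sum>n\<in>A. (d n)\<^sup>2) \<le> 1\<close> by simp
      finally show ?thesis
        by (simp add: abs_square_le_1 abs_le_iff)
    qed
    with that have "d' \<in> S"
      unfolding S_def B_def d'_def by auto
    moreover have "trig_sum A d' = trig_sum A d"
      unfolding trig_sum_def d'_def by auto
    ultimately show ?thesis
      using c(2)[of d'] by (simp add: F_def)
  qed
  have "lambda_const q A = F c"
    unfolding lambda_const_def F_def[symmetric]
    by (rule cSup_eq_maximum) (use c(1) ub in \<open>auto simp: S_def F_def\<close>)
  with c(1) ub show ?thesis
    by (auto simp: S_def F_def)
qed

text \<open>For real \<open>K\<close> arbitrarily close to 1 the two-element set \<open>{-1, 1}\<close> violates the bound when
  \<open>\<gamma>\<close> is small, because it is as large as its product set while its constant exceeds 1. The sets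
  with more than one element and no more products than elements are exactly
  \<open>{0, a}\<close>, \<open>{-a, a}\<close> and \<open>{-a, 0, a}\<close> with \<open>a \<noteq> 0\<close>; for them \<open>K\<close> has to be bounded
  away from 1, whereas \<open>K > 5/4\<close> is automatic for all other sets with more than one element.\<close>

lemma lambda_const_pair_exceeds:
  "\<exists>K. real (card ({-1, 1 :: int} * {-1, 1})) < K * real (card {-1, 1 :: int}) \<and>
       \<not> lambda_const 4 {-1, 1} < K powr L * real (card {-1, 1 :: int}) powr (1/10)"
proof -
  let ?A = "{-1, 1 :: int}"
  define c where "c = (\<lambda>n::int. 1 / sqrt 2)"
  have sq: "sqrt (\<Sum>n\<in>?A. (c n)\<^sup>2) \<le> 1"
    by (simp add: c_def power_divide)
  have ts: "trig_sum ?A c \<theta> = of_real (sqrt 2 * cos (2 * pi * \<theta>))" for \<theta>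
  proof -
    have e: "exp (2 * of_real pi * \<i> * of_int n * of_real \<theta>) = cis (2 * pi * n * \<theta>)" for n
      by (simp add: cis_conv_exp mult_ac)
    have "trig_sum ?A c \<theta> = of_real (1 / sqrt 2) * (cis (- (2 * pi * \<theta>)) + cis (2 * pi * \<theta>))"
      unfolding trig_sum_def e c_def by (simp add: algebra_simps)
    also have "\<dots> = of_real (2 / sqrt 2 * cos (2 * pi * \<theta>))"
      by (simp add: complex_eq_iff)
    also have "2 / sqrt 2 = sqrt 2"
      by (simp add: real_div_sqrt)
    finally show ?thesis .
  qed
  have pw: "cmod (trig_sum ?A c \<theta>) powr 4 = 4 * cos (2 * pi * \<theta>) ^ 4" for \<theta>
  proof -
    have "(sqrt 2 :: real) ^ 4 = (sqrt 2 ^ 2) ^ 2"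
      by (simp only: flip: power_mult) simp
    then have "sqrt 2 ^ 4 = (4 :: real)"
      by simp
    moreover have "cmod (trig_sum ?A c \<theta>) powr 4 = \<bar>sqrt 2 * cos (2 * pi * \<theta>)\<bar> ^ 4"
      unfolding ts norm_of_real by (cases "cos (2 * pi * \<theta>) = 0") auto
    ultimately show ?thesis
      by (simp add: power_mult_distrib power_even_abs)
  qed
  define G where "G = (\<lambda>\<theta>. 3/2 * \<theta> + (cos (2 * pi * \<theta>) ^ 3 * sin (2 * pi * \<theta>)
      + 3/2 * cos (2 * pi * \<theta>) * sin (2 * pi * \<theta>)) / (2 * pi))"
  have "((\<lambda>\<theta>. 4 * cos (2 * pi * \<theta>) ^ 4) has_integral (G 1 - G 0)) {0..1}"
  proof (rule fundamental_theorem_of_calculus)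
    fix \<theta> :: real
    have s: "sin (2 * pi * \<theta>) ^ 2 = 1 - cos (2 * pi * \<theta>) ^ 2"
      by (simp add: sin_squared_eq)
    have "(G has_real_derivative (3/2 + (cos (2 * pi * \<theta>) ^ 4
       - 3 * cos (2 * pi * \<theta>) ^ 2 * sin (2 * pi * \<theta>) ^ 2
       + 3/2 * (cos (2 * pi * \<theta>) ^ 2 - sin (2 * pi * \<theta>) ^ 2)))) (at \<theta> within {0..1})"
      unfolding G_def
      by (rule derivative_eq_intros refl | simp)+
         (simp add: field_simps power2_eq_square power4_eq_xxxx power3_eq_cube)
    also have "3/2 + (cos (2 * pi * \<theta>) ^ 4
       - 3 * cos (2 * pi * \<theta>) ^ 2 * sin (2 * pi * \<theta>) ^ 2
       + 3/2 * (cos (2 * pi * \<theta>) ^ 2 - sin (2 * pi * \<theta>) ^ 2)) = 4 * cos (2 * pi * \<theta>) ^ 4"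
      unfolding s by (simp add: algebra_simps power2_eq_square power4_eq_xxxx)
    finally show "(G has_vector_derivative 4 * cos (2 * pi * \<theta>) ^ 4) (at \<theta> within {0..1})"
      by (simp add: has_real_derivative_iff_has_vector_derivative)
  qed simp
  then have int: "integral {0..1} (\<lambda>\<theta>. 4 * cos (2 * pi * \<theta>) ^ 4) = 3/2"
    by (subst integral_unique) (auto simp: G_def)
  have "circle_norm 4 (trig_sum ?A c) = (3/2) powr (1/4)"
    unfolding circle_norm_def pw
    by (subst set_borel_integral_eq_integral(2)[OF borel_integrable_atLeastAtMost'])
       (auto intro!: continuous_intros simp: int simp del: integral_mult_right)
  then have lam: "(3/2) powr (1/4) \<le> lambda_const 4 ?A"
    using lambda_const_attained[of ?A 4] sq by fastforce
  have "((2::real) powr (1/10)) powr 20 < ((3/2) powr (1/4)) powr 20"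
    by (simp add: powr_powr power_divide)
  then have lt: "(2::real) powr (1/10) < (3/2) powr (1/4)"
    using powr_less_cancel2[of 20] by fastforce
  have "((\<lambda>K. K powr L * 2 powr (1/10)) \<longlongrightarrow> 1 powr L * 2 powr (1/10)) (at_right (1::real))"
    by (intro tendsto_intros) auto
  then have "\<forall>\<^sub>F K in at_right 1. K powr L * 2 powr (1/10) < (3/2 :: real) powr (1/4)"
    using lt by (intro order_tendstoD(2)) auto
  moreover have "\<forall>\<^sub>F K in at_right (1::real). K > 1"
    by (simp add: eventually_at_right_less)
  ultimately obtain K :: real where K: "K powr L * 2 powr (1/10) < (3/2) powr (1/4)" "K > 1"
    by (metis (mono_tags, lifting) eventually_conj eventually_happens trivial_limit_at_right_real)
  have "?A * ?A = ?A"
    by (auto simp: set_times_def)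
  with K lam show ?thesis
    by (intro exI[of _ K]) auto
qed

end

theory Submission
  imports Defs
begin

text \<open>Describe the nonzero elements of \<open>A\<close>, up to sign, by their \<open>p\<close>-adic valuations, and think of
  determining an element by asking for one valuation after the other, where the choice of the
  question may depend on the answers so far. Two facts about this procedure, one analytic and one combinatorial, give
  \<open>\<lambda>\<^sub>q(A) \<le> C K\<^sup>L\<close> with \<open>C\<close> and \<open>L\<close> depending on \<open>q\<close> only; the factor \<open>N\<^sup>\<gamma>\<close> merely swallows \<open>C\<close> when
  \<open>N\<close> is large, and \<open>K \<ge> 1 + 1/N\<close> does so when \<open>N\<close> is small.

  The analytic fact concerns even exponents \<open>2k \<ge> q\<close>. Group the frequencies of a trigonometric sum
  by the valuation at one prime. The groups behave like martingale differences, so the squared norm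
  of the sum is at most \<open>D\<close> times the sum of the squared norms of the groups
  (\<open>moment_valuation_split\<close>). Iterating, a sum over elements that have been singled out by queries
  obeys an \<open>\<ell>\<^sup>2\<close> bound in which an element found after \<open>d\<close> queries costs \<open>D\<^sup>d\<close>, in other words has
  weight \<open>D\<^sup>-\<^sup>d\<close>. This structure depends on the valuations up to translation and reflection only. Hence
  the sum over all of \<open>A\<close> can be averaged over the copies \<open>x/b\<close>, with \<open>x \<in> AA\<close>, of such a weighted
  set, and one obtains a bound for \<open>\<lambda>\<^sub>2\<^sub>k(A)\<^sup>2\<close> of order \<open>|AA|/W\<close>, where \<open>W\<close> is the total weight
  (\<open>moment_le_of_dominating\<close>).

  The combinatorial fact is that a small product set forces \<open>W\<close> to be large. The largest total
  weight satisfies a recursion over the primes: either keep one fibre of the valuation and discard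
  the others, or query, which keeps all fibres and costs a factor \<open>D\<close> (\<open>query_weight\<close>). For a small
  \<open>e > 0\<close> the quantity \<open>\<Psi>(A) = |A|\<^sup>1\<^sup>+\<^sup>e W\<^sup>-\<^sup>e\<close> satisfies \<open>\<Psi>(A) \<Psi>(B) \<le> |AB|\<^sup>2\<close>
  (\<open>product_set_growth\<close>), by induction over the primes. The products of fibres over distinct sums
  of valuations are disjoint, and the order of the exponents supplies enough such sums: sets of
  \<open>r\<close> and \<open>s\<close> integers have at least \<open>r + s - 1\<close> sums (\<open>chain_exists\<close>, \<open>sumset_growth_step\<close>). If several fibres
  matter, this gain pays for a query; if one fibre dominates, it pays for discarding the others
  (\<open>gain_inequality\<close>). With \<open>B = A\<close> this gives \<open>|A|/W \<le> (|AA|/|A|)\<^sup>1\<^sup>/\<^sup>e\<close>.\<close>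

section \<open>Moments of even order\<close>

text \<open>Several estimates are obtained after dividing by the bounds involved, hence for positive bounds
  only; letting an added \<open>\<epsilon>\<close> tend to zero covers the remaining case.\<close>

lemma le_of_le_add_eps:
  fixes \<phi> :: "real \<Rightarrow> real"
  assumes "isCont \<phi> 0" and le: "\<And>\<epsilon>. \<epsilon> > 0 \<Longrightarrow> x \<le> \<phi> \<epsilon>"
  shows "x \<le> \<phi> 0"
proof (rule tendsto_lowerbound)
  show "(\<phi> \<longlongrightarrow> \<phi> 0) (at_right 0)"
    using assms(1) by (simp add: isCont_def filterlim_at_split)
  show "\<forall>\<^sub>F \<epsilon> in at_right 0. x \<le> \<phi> \<epsilon>"
    unfolding eventually_at_right_field using le by (intro exI[of _ 1]) auto
qed simp

text \<open>This is the \<open>2k\<close>-th power of the \<open>L\<^sup>2\<^sup>k\<close> norm. It is compared with \<open>\<alpha>\<^sup>k\<close>, where \<open>\<alpha>\<close> bounds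
  the squared norm, because squared norms are the quantities that add up below.\<close>

definition moment :: "nat \<Rightarrow> (real \<Rightarrow> complex) \<Rightarrow> real" where
  "moment k f = integral {0..1} (\<lambda>\<theta>. cmod (f \<theta>) ^ (2 * k))"

lemma continuous_on_trig_sum: "continuous_on X (trig_sum A c)"
  unfolding trig_sum_def by (intro continuous_intros)

text \<open>Convexity of \<open>t\<^sup>2\<^sup>k\<close>, applied to the terms \<open>f i\<close> scaled to size \<open>B i\<close>, is the pointwise form of
  Minkowski's inequality.\<close>

lemma norm_sum_power_le:
  fixes f :: "'i \<Rightarrow> 'a::real_normed_vector"
  assumes X: "finite X" "X \<noteq> {}" and B: "\<And>i. i \<in> X \<Longrightarrow> B i > (0::real)"
  shows "norm (\<Sum>i\<in>X. f i) ^ (2 * k) \<le> sum B X ^ (2 * k) * (\<Sum>i\<in>X. B i / sum B X * (norm (f i) / B i) ^ (2 * k))"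
proof -
  let ?s = "sum B X"
  have s: "?s > 0" using X B by (intro sum_pos) auto
  have "norm (\<Sum>i\<in>X. f i) \<le> (\<Sum>i\<in>X. norm (f i))" by (rule norm_sum)
  also have "\<dots> = ?s * (\<Sum>i\<in>X. (B i / ?s) *\<^sub>R (norm (f i) / B i))"
    using s B by (simp add: sum_distrib_left less_imp_neq[symmetric])
  finally have "norm (\<Sum>i\<in>X. f i) ^ (2 * k) \<le> (?s * (\<Sum>i\<in>X. (B i / ?s) *\<^sub>R (norm (f i) / B i))) ^ (2 * k)"
    by (intro power_mono) auto
  also have "\<dots> = ?s ^ (2 * k) * (\<Sum>i\<in>X. (B i / ?s) *\<^sub>R (norm (f i) / B i)) ^ (2 * k)"
    by (rule power_mult_distrib)
  also have "(\<Sum>i\<in>X. (B i / ?s) *\<^sub>R (norm (f i) / B i)) ^ (2 * k) \<le> (\<Sum>i\<in>X. B i / ?s * (norm (f i) / B i) ^ (2 * k))"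
    by (rule convex_on_sum[OF X convex_power_even])
       (use s B in \<open>auto simp: less_imp_le simp flip: sum_divide_distrib\<close>)
  finally show ?thesis using s by (simp add: mult_left_mono)
qed

text \<open>Minkowski's inequality, with upper bounds in place of the norms themselves.\<close>

lemma moment_sum_le:
  fixes f :: "'i \<Rightarrow> real \<Rightarrow> complex"
  assumes X: "finite X" and B: "\<And>i. i \<in> X \<Longrightarrow> B i \<ge> 0"
    and cont: "\<And>i. i \<in> X \<Longrightarrow> continuous_on {0..1} (f i)"
    and le: "\<And>i. i \<in> X \<Longrightarrow> moment k (f i) \<le> B i ^ (2 * k)" and k: "k > 0"
  shows "moment k (\<lambda>\<theta>. \<Sum>i\<in>X. f i \<theta>) \<le> sum B X ^ (2 * k)"
proof (cases "X = {}")
  case True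
  then show ?thesis using k by (simp add: moment_def)
next
  case False
  have pos: "moment k (\<lambda>\<theta>. \<Sum>i\<in>X. f i \<theta>) \<le> sum B X ^ (2 * k)"
    if B: "\<And>i. i \<in> X \<Longrightarrow> B i > 0" and le: "\<And>i. i \<in> X \<Longrightarrow> moment k (f i) \<le> B i ^ (2 * k)"
    for B :: "'i \<Rightarrow> real"
  proof -
    let ?s = "sum B X"
    have s: "?s > 0" using X False B by (intro sum_pos) auto
    have c: "continuous_on {0..1} (\<lambda>\<theta>. cmod (f i \<theta>) ^ (2 * k))" if "i \<in> X" for i
      using cont[OF that] by (intro continuous_intros)
    have "moment k (\<lambda>\<theta>. \<Sum>i\<in>X. f i \<theta>)
        \<le> integral {0..1} (\<lambda>\<theta>. \<Sum>i\<in>X. ?s ^ (2 * k) * (B i / ?s) / B i ^ (2 * k) * cmod (f i \<theta>) ^ (2 * k))"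
      unfolding moment_def
    proof (rule integral_le)
      show "(\<lambda>\<theta>. cmod (\<Sum>i\<in>X. f i \<theta>) ^ (2 * k)) integrable_on {0..1}"
        by (intro integrable_continuous_interval continuous_intros cont)
      show "(\<lambda>\<theta>. \<Sum>i\<in>X. ?s ^ (2 * k) * (B i / ?s) / B i ^ (2 * k) * cmod (f i \<theta>) ^ (2 * k)) integrable_on {0..1}"
        by (intro integrable_continuous_interval continuous_intros cont)
      show "cmod (\<Sum>i\<in>X. f i \<theta>) ^ (2 * k) \<le> (\<Sum>i\<in>X. ?s ^ (2 * k) * (B i / ?s) / B i ^ (2 * k) * cmod (f i \<theta>) ^ (2 * k))" for \<theta>
        using norm_sum_power_le[OF X False B, where f = "\<lambda>i. f i \<theta>" and k = k]
        by (simp only: sum_distrib_left power_divide times_divide_eq_right times_divide_eq_left divide_divide_eq_left mult.assoc)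
    qed
    also have "\<dots> = (\<Sum>i\<in>X. ?s ^ (2 * k) * (B i / ?s) / B i ^ (2 * k) * moment k (f i))"
      unfolding moment_def
      by (intro integral_unique has_integral_sum X has_integral_mult_right integrable_integral
          integrable_continuous_interval c)
    also have "\<dots> \<le> (\<Sum>i\<in>X. ?s ^ (2 * k) * (B i / ?s))"
    proof (rule sum_mono)
      fix i assume i: "i \<in> X"
      have "moment k (f i) / B i ^ (2 * k) \<le> 1"
        using le[OF i] B[OF i] by simp
      then have "?s ^ (2 * k) * (B i / ?s) * (moment k (f i) / B i ^ (2 * k)) \<le> ?s ^ (2 * k) * (B i / ?s) * 1"
        using s B[OF i] by (intro mult_left_mono) auto
      then show "?s ^ (2 * k) * (B i / ?s) / B i ^ (2 * k) * moment k (f i) \<le> ?s ^ (2 * k) * (B i / ?s)"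
        by simp
    qed
    also have "\<dots> = ?s ^ (2 * k)"
      using s by (simp flip: sum_distrib_left sum_divide_distrib)
    finally show ?thesis .
  qed
  have "moment k (\<lambda>\<theta>. \<Sum>i\<in>X. f i \<theta>) \<le> (\<Sum>i\<in>X. B i + 0) ^ (2 * k)"
  proof (rule le_of_le_add_eps[where \<phi> = "\<lambda>\<epsilon>. (\<Sum>i\<in>X. B i + \<epsilon>) ^ (2 * k)"])
    fix \<epsilon> :: real assume "\<epsilon> > 0"
    then show "moment k (\<lambda>\<theta>. \<Sum>i\<in>X. f i \<theta>) \<le> (\<Sum>i\<in>X. B i + \<epsilon>) ^ (2 * k)"
      by (intro pos) (use B le in \<open>force intro: add_nonneg_pos order_trans[OF le power_mono]\<close>)+
  qed (intro continuous_intros)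
  then show ?thesis by simp
qed

text \<open>Expand the power of \<open>|f + g|\<^sup>2 = |f|\<^sup>2 + 2 Re (cnj f * g) + |g|\<^sup>2\<close>. The part linear in \<open>g\<close> is kept
  exactly, since it integrates to zero in the application; all other terms are at least quadratic
  in \<open>g\<close> and are absorbed in the error.\<close>

lemma norm_add_power_le:
  "\<exists>C\<ge>1. \<forall>f g :: complex. cmod (f + g) ^ (2 * Suc m) \<le> cmod f ^ (2 * Suc m)
      + 2 * real (Suc m) * (cmod f ^ (2 * m) * Re (cnj f * g))
      + C * (cmod f ^ (2 * m) * cmod g ^ 2 + cmod g ^ (2 * Suc m))"
proof (induction m)
  case 0
  have "cmod (f + g) ^ 2 = cmod f ^ 2 + 2 * Re (cnj f * g) + cmod g ^ 2" for f g
    by (simp add: cmod_power2) (simp add: power2_eq_square algebra_simps)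
  then show ?case by (intro exI[of _ 1]) auto
next
  case (Suc m)
  then obtain C where C: "C \<ge> 1" and IH: "\<And>f g :: complex. cmod (f + g) ^ (2 * Suc m) \<le> cmod f ^ (2 * Suc m)
      + 2 * real (Suc m) * (cmod f ^ (2 * m) * Re (cnj f * g))
      + C * (cmod f ^ (2 * m) * cmod g ^ 2 + cmod g ^ (2 * Suc m))" by blast
  \<comment> \<open>multiplying the hypothesis by \<open>|f + g|\<^sup>2 \<le> 2(|f|\<^sup>2 + |g|\<^sup>2)\<close> produces these constants\<close>
  define D where "D = 1 + 6 * real (Suc m) + 8 * C"
  have "cmod (f + g) ^ (2 * Suc (Suc m)) \<le> cmod f ^ (2 * Suc (Suc m))
      + 2 * real (Suc (Suc m)) * (cmod f ^ (2 * Suc m) * Re (cnj f * g))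
      + D * (cmod f ^ (2 * Suc m) * cmod g ^ 2 + cmod g ^ (2 * Suc (Suc m)))" for f g
  proof -
    define x y t P where defs: "x = cmod f ^ 2" "y = cmod g ^ 2" "t = Re (cnj f * g)" "P = x ^ m"
    define k where "k = real (Suc m)"
    have nn: "x \<ge> 0" "y \<ge> 0" "P \<ge> 0" "k \<ge> 0" by (auto simp: defs k_def)
    have sq: "cmod (f + g) ^ 2 = x + 2 * t + y"
      unfolding defs by (simp add: cmod_power2) (simp add: power2_eq_square algebra_simps)
    have "\<bar>t\<bar> \<le> cmod f * cmod g"
      unfolding defs using abs_Re_le_cmod[of "cnj f * g"] by (simp add: norm_mult)
    then have t2: "t ^ 2 \<le> x * y"
      unfolding defs(1,2) by (metis abs_le_square_iff abs_mult abs_norm_cancel power_mult_distrib)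
    have tle: "2 * \<bar>t\<bar> \<le> x + y"
    proof -
      have "2 * (cmod f * cmod g) \<le> x + y" unfolding defs
        using sum_squares_bound[of "cmod f" "cmod g"] by simp
      then show ?thesis using \<open>\<bar>t\<bar> \<le> cmod f * cmod g\<close> by linarith
    qed
    have pw: "cmod f ^ (2 * n) = x ^ n" "cmod g ^ (2 * n) = y ^ n" for n
      by (auto simp: defs power_mult)
    have e: "(x + 2 * t + y) ^ Suc m \<le> x * P + 2 * k * (P * t) + C * (P * y + y ^ Suc m)"
      using IH[of f g] by (simp only: pw power_mult sq k_def) (simp add: defs)
    have q0: "0 \<le> x + 2 * t + y" using sq by (metis zero_le_power2)
    have q1: "x + 2 * t + y \<le> 2 * (x + y)" using tle by (auto simp: abs_if split: if_splits)
    have Pyy: "P * y * y \<le> x * P * y + y ^ Suc (Suc m)"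
    proof (cases "x \<le> y")
      case True
      then have "P \<le> y ^ m" unfolding defs(4) using nn by (intro power_mono)
      then have "P * (y * y) \<le> y ^ m * (y * y)" using nn by (intro mult_right_mono) auto
      moreover have "0 \<le> x * P * y" using nn by simp
      ultimately show ?thesis by (simp add: mult_ac)
    next
      case False
      then have "P * y * y \<le> P * y * x" using nn by (intro mult_left_mono) auto
      moreover have "0 \<le> y ^ Suc (Suc m)" using nn by simp
      ultimately show ?thesis by (simp add: mult_ac)
    qed
    have xyy: "x * y ^ Suc m \<le> x * P * y + y ^ Suc (Suc m)"
    proof (cases "x \<le> y")
      case True
      then have "x * y ^ Suc m \<le> y * y ^ Suc m" using nn by (intro mult_right_mono) auto
      moreover have "0 \<le> x * P * y" using nn by simp
      ultimately show ?thesis by simp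
    next
      case False
      then have "y ^ m \<le> P" unfolding defs(4) using nn by (intro power_mono) auto
      then have "x * y * y ^ m \<le> x * y * P" using nn by (intro mult_left_mono) auto
      moreover have "0 \<le> y ^ Suc (Suc m)" using nn by simp
      ultimately show ?thesis by (simp add: mult_ac)
    qed
    define R where "R = x * P * y + y ^ Suc (Suc m)"
    have R: "x * P * y \<le> R" "y * y ^ Suc m \<le> R" "P * y * y \<le> R" "x * y ^ Suc m \<le> R"
      using Pyy xyy nn by (auto simp: R_def)
    have "2 * t * t \<le> 2 * (x * y)" "2 * t * y \<le> x * y + y * y"
      using t2 mult_right_mono[OF tle nn(2)] mult_right_mono[OF abs_ge_self[of t] nn(2)]
      by (auto simp: power2_eq_square algebra_simps)
    then have "(2 * t + y) * t * 2 \<le> 5 * (x * y) + y * y"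
      using t2 by (auto simp: power2_eq_square algebra_simps)
    then have "k * P * ((2 * t + y) * t * 2) \<le> k * P * (5 * (x * y) + y * y)"
      using nn by (intro mult_left_mono) auto
    also have "\<dots> = k * (5 * (x * P * y) + P * y * y)" by (simp add: algebra_simps)
    also have "\<dots> \<le> k * (6 * R)" using R nn by (intro mult_left_mono) auto
    finally have b1: "k * P * ((2 * t + y) * t * 2) \<le> 6 * k * R" by simp
    have "(x + 2 * t + y) * (C * (P * y + y ^ Suc m)) \<le> 2 * (x + y) * (C * (P * y + y ^ Suc m))"
      using q1 nn C by (intro mult_right_mono) auto
    also have "\<dots> = 2 * C * (x * P * y + y * y ^ Suc m + P * y * y + x * y ^ Suc m)"
      by (simp add: algebra_simps)
    also have "\<dots> \<le> 2 * C * (4 * R)" using R C by (intro mult_left_mono) auto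
    finally have b2: "(x + 2 * t + y) * (C * (P * y + y ^ Suc m)) \<le> 8 * C * R" by simp
    have "cmod (f + g) ^ (2 * Suc (Suc m)) = (x + 2 * t + y) * (x + 2 * t + y) ^ Suc m"
      by (simp only: power_mult sq power_Suc)
    also have "\<dots> \<le> (x + 2 * t + y) * (x * P + 2 * k * (P * t) + C * (P * y + y ^ Suc m))"
      by (rule mult_left_mono[OF e q0])
    also have "\<dots> = x * x * P + 2 * (k + 1) * (x * P * t) + x * P * y + k * P * ((2 * t + y) * t * 2)
        + (x + 2 * t + y) * (C * (P * y + y ^ Suc m))"
      by (simp add: algebra_simps)
    also have "\<dots> \<le> x * x * P + 2 * (k + 1) * (x * P * t) + R + 6 * k * R + 8 * C * R"
      using b1 b2 R by linarith
    also have "\<dots> = x * x * P + 2 * (k + 1) * (x * P * t) + D * R"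
      by (simp add: D_def k_def algebra_simps)
    finally show ?thesis
      by (simp only: pw R_def k_def) (simp add: defs algebra_simps)
  qed
  moreover have "D \<ge> 1" using C by (simp add: D_def)
  ultimately show ?case by blast
qed

text \<open>Weighted arithmetic and geometric means with weights \<open>m\<close> and \<open>1\<close>.\<close>

lemma power_times_le:
  fixes x y :: real
  assumes "x \<ge> 0" "y \<ge> 0"
  shows "real (Suc m) * (x ^ m * y) \<le> real m * x ^ Suc m + y ^ Suc m"
proof (induction m)
  case (Suc m)
  have "0 \<le> (x - y) * (x ^ Suc m - y ^ Suc m)"
    using assms power_mono[of x y "Suc m"] power_mono[of y x "Suc m"]
    by (cases "x \<le> y") (auto intro: mult_nonpos_nonpos mult_nonneg_nonneg)
  moreover have "x * (real (Suc m) * (x ^ m * y)) \<le> x * (real m * x ^ Suc m + y ^ Suc m)"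
    using Suc assms by (intro mult_left_mono)
  ultimately show ?case by (simp add: algebra_simps)
qed simp

text \<open>Hoelder's inequality for the exponents of \<open>|f|\<^sup>2\<^sup>m |g|\<^sup>2\<close>: after scaling both functions to norm one
  it is \<open>power_times_le\<close> integrated.\<close>

lemma integral_mixed_le:
  assumes f: "continuous_on {0..1} f" and g: "continuous_on {0..1} g"
    and \<alpha>: "\<alpha> > 0" and \<beta>: "\<beta> > 0"
    and mf: "moment (Suc m) f \<le> \<alpha> ^ Suc m" and mg: "moment (Suc m) g \<le> \<beta> ^ Suc m"
  shows "integral {0..1} (\<lambda>\<theta>. cmod (f \<theta>) ^ (2 * m) * cmod (g \<theta>) ^ 2) \<le> \<alpha> ^ m * \<beta>"
proof -
  \<comment> \<open>the coefficients that scaling to norm one leaves in front of the two moments\<close>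
  define a b where "a = \<alpha> ^ m * \<beta> * real m / \<alpha> ^ Suc m" and "b = \<alpha> ^ m * \<beta> / \<beta> ^ Suc m"
  have ab: "a \<ge> 0" "b \<ge> 0" using \<alpha> \<beta> by (auto simp: a_def b_def)
  have pt: "real (Suc m) * (X ^ (2 * m) * Y ^ 2) \<le> a * X ^ (2 * Suc m) + b * Y ^ (2 * Suc m)"
    for X Y :: real
  proof -
    have "real (Suc m) * ((X ^ 2 / \<alpha>) ^ m * (Y ^ 2 / \<beta>))
       \<le> real m * (X ^ 2 / \<alpha>) ^ Suc m + (Y ^ 2 / \<beta>) ^ Suc m"
      using \<alpha> \<beta> by (intro power_times_le) auto
    then have "(\<alpha> ^ m * \<beta>) * (real (Suc m) * ((X ^ 2 / \<alpha>) ^ m * (Y ^ 2 / \<beta>)))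
       \<le> (\<alpha> ^ m * \<beta>) * (real m * (X ^ 2 / \<alpha>) ^ Suc m + (Y ^ 2 / \<beta>) ^ Suc m)"
      using \<alpha> \<beta> by (intro mult_left_mono) auto
    also have "(\<alpha> ^ m * \<beta>) * (real (Suc m) * ((X ^ 2 / \<alpha>) ^ m * (Y ^ 2 / \<beta>)))
       = real (Suc m) * (X ^ (2 * m) * Y ^ 2)"
      using \<alpha> \<beta> by (simp add: power_divide power_mult)
    also have "(\<alpha> ^ m * \<beta>) * (real m * (X ^ 2 / \<alpha>) ^ Suc m + (Y ^ 2 / \<beta>) ^ Suc m)
       = a * X ^ (2 * Suc m) + b * Y ^ (2 * Suc m)"
      unfolding a_def b_def power_divide power_mult by (simp add: ring_distribs)
    finally show ?thesis .
  qed
  have "real (Suc m) * integral {0..1} (\<lambda>\<theta>. cmod (f \<theta>) ^ (2 * m) * cmod (g \<theta>) ^ 2)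
      = integral {0..1} (\<lambda>\<theta>. real (Suc m) * (cmod (f \<theta>) ^ (2 * m) * cmod (g \<theta>) ^ 2))"
    by simp
  also have "\<dots> \<le> integral {0..1} (\<lambda>\<theta>. a * cmod (f \<theta>) ^ (2 * Suc m) + b * cmod (g \<theta>) ^ (2 * Suc m))"
    by (intro integral_le integrable_continuous_interval continuous_intros f g pt)
  also have "\<dots> = a * moment (Suc m) f + b * moment (Suc m) g"
    unfolding moment_def
    by (subst integral_add) (auto intro!: integrable_continuous_interval continuous_intros f g simp del: power_Suc mult_Suc_right)
  also have "\<dots> \<le> a * \<alpha> ^ Suc m + b * \<beta> ^ Suc m"
    using mf mg ab by (intro add_mono mult_left_mono)
  also have "\<dots> = real (Suc m) * (\<alpha> ^ m * \<beta>)"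
    using \<alpha> \<beta> by (simp add: a_def b_def algebra_simps)
  finally show ?thesis by (simp only: mult_le_cancel_left_pos of_nat_0_less_iff zero_less_Suc)
qed

text \<open>As the term linear in \<open>g\<close> vanishes, adding \<open>g\<close> increases the squared norm by a multiple of
  the squared norm of \<open>g\<close>. The coefficient of \<open>\<alpha>\<close> is exactly one, so that any number of pieces
  can be added one after the other without accumulating constants.\<close>

lemma moment_add_orthogonal_le:
  "\<exists>D\<ge>1. \<forall>f g \<alpha> \<beta>. continuous_on {0..1} f \<longrightarrow> continuous_on {0..1} g \<longrightarrow> \<alpha> \<ge> 0 \<longrightarrow> \<beta> \<ge> 0 \<longrightarrow>
     moment (Suc m) f \<le> \<alpha> ^ Suc m \<longrightarrow> moment (Suc m) g \<le> \<beta> ^ Suc m \<longrightarrow>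
     integral {0..1} (\<lambda>\<theta>. cmod (f \<theta>) ^ (2 * m) * Re (cnj (f \<theta>) * g \<theta>)) = 0 \<longrightarrow>
     moment (Suc m) (\<lambda>\<theta>. f \<theta> + g \<theta>) \<le> (\<alpha> + D * \<beta>) ^ Suc m"
proof -
  obtain C where C: "C \<ge> 1" and pt: "\<And>f g :: complex. cmod (f + g) ^ (2 * Suc m) \<le> cmod f ^ (2 * Suc m)
      + 2 * real (Suc m) * (cmod f ^ (2 * m) * Re (cnj f * g))
      + C * (cmod f ^ (2 * m) * cmod g ^ 2 + cmod g ^ (2 * Suc m))"
    using norm_add_power_le by blast
  have pos: "moment (Suc m) (\<lambda>\<theta>. f \<theta> + g \<theta>) \<le> (\<alpha> + 2 * C * \<beta>) ^ Suc m"
    if f: "continuous_on {0..1} f" and g: "continuous_on {0..1} g" and ab: "\<alpha> > 0" "\<beta> > 0"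
      and mf: "moment (Suc m) f \<le> \<alpha> ^ Suc m" and mg: "moment (Suc m) g \<le> \<beta> ^ Suc m"
      and orth: "integral {0..1} (\<lambda>\<theta>. cmod (f \<theta>) ^ (2 * m) * Re (cnj (f \<theta>) * g \<theta>)) = 0"
    for f g \<alpha> \<beta>
  proof -
    have "moment (Suc m) (\<lambda>\<theta>. f \<theta> + g \<theta>) \<le> integral {0..1} (\<lambda>\<theta>. cmod (f \<theta>) ^ (2 * Suc m)
      + 2 * real (Suc m) * (cmod (f \<theta>) ^ (2 * m) * Re (cnj (f \<theta>) * g \<theta>))
      + C * (cmod (f \<theta>) ^ (2 * m) * cmod (g \<theta>) ^ 2 + cmod (g \<theta>) ^ (2 * Suc m)))"
      unfolding moment_def
      by (intro integral_le integrable_continuous_interval continuous_intros f g pt)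
    also have "\<dots> = moment (Suc m) f
      + 2 * real (Suc m) * integral {0..1} (\<lambda>\<theta>. cmod (f \<theta>) ^ (2 * m) * Re (cnj (f \<theta>) * g \<theta>))
      + C * (integral {0..1} (\<lambda>\<theta>. cmod (f \<theta>) ^ (2 * m) * cmod (g \<theta>) ^ 2) + moment (Suc m) g)"
      unfolding moment_def
      by (intro integral_unique has_integral_add has_integral_mult_right integrable_integral
          integrable_continuous_interval continuous_intros f g)
    also have "\<dots> \<le> \<alpha> ^ Suc m + 0 + C * (\<alpha> ^ m * \<beta> + \<beta> ^ Suc m)"
      using C mf mg integral_mixed_le[OF f g ab mf mg] unfolding orth
      by (intro add_mono mult_left_mono) auto
    also have "\<dots> \<le> (\<alpha> + 2 * C * \<beta>) ^ Suc m"
    proof -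
      \<comment> \<open>half of \<open>z\<close> absorbs the mixed term, the other half the pure power of \<open>\<beta>\<close>\<close>
      define z where "z = 2 * C * \<beta>"
      have z: "z \<ge> 0" using C ab by (simp add: z_def)
      have "(\<alpha> + z) * \<alpha> ^ m \<le> (\<alpha> + z) * (\<alpha> + z) ^ m"
        using z ab by (intro mult_left_mono power_mono) auto
      then have 1: "\<alpha> ^ Suc m + \<alpha> ^ m * z \<le> (\<alpha> + z) ^ Suc m" by (simp add: algebra_simps)
      have "\<alpha> * \<alpha> ^ m + z * z ^ m \<le> \<alpha> * (\<alpha> + z) ^ m + z * (\<alpha> + z) ^ m"
        using z ab by (intro add_mono mult_left_mono power_mono) auto
      then have 2: "\<alpha> ^ Suc m + z ^ Suc m \<le> (\<alpha> + z) ^ Suc m" by (simp add: algebra_simps)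
      have "(2 * C) ^ 1 \<le> (2 * C) ^ Suc m" using C by (intro power_increasing) auto
      then have "2 * C * \<beta> ^ Suc m \<le> z ^ Suc m"
        unfolding z_def power_mult_distrib[of "2 * C"] using ab by (intro mult_right_mono) auto
      then show ?thesis using 1 2 by (simp add: z_def algebra_simps)
    qed
    finally show ?thesis .
  qed
  show ?thesis
  proof (intro exI[of _ "2 * C"] conjI allI impI)
    fix f g :: "real \<Rightarrow> complex" and \<alpha> \<beta> :: real
    assume f: "continuous_on {0..1} f" and g: "continuous_on {0..1} g" and ab: "\<alpha> \<ge> 0" "\<beta> \<ge> 0"
      and mf: "moment (Suc m) f \<le> \<alpha> ^ Suc m" and mg: "moment (Suc m) g \<le> \<beta> ^ Suc m"
      and orth: "integral {0..1} (\<lambda>\<theta>. cmod (f \<theta>) ^ (2 * m) * Re (cnj (f \<theta>) * g \<theta>)) = 0"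
    have "moment (Suc m) (\<lambda>\<theta>. f \<theta> + g \<theta>) \<le> ((\<alpha> + 0) + 2 * C * (\<beta> + 0)) ^ Suc m"
    proof (rule le_of_le_add_eps[where \<phi> = "\<lambda>\<epsilon>. ((\<alpha> + \<epsilon>) + 2 * C * (\<beta> + \<epsilon>)) ^ Suc m"])
      fix \<epsilon> :: real assume "\<epsilon> > 0"
      then show "moment (Suc m) (\<lambda>\<theta>. f \<theta> + g \<theta>) \<le> ((\<alpha> + \<epsilon>) + 2 * C * (\<beta> + \<epsilon>)) ^ Suc m"
        using ab by (intro pos f g orth order_trans[OF mf power_mono] order_trans[OF mg power_mono]) auto
    qed (intro continuous_intros)
    then show "moment (Suc m) (\<lambda>\<theta>. f \<theta> + g \<theta>) \<le> (\<alpha> + 2 * C * \<beta>) ^ Suc m" by simp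
  qed (use C in auto)
qed

section \<open>Frequencies of different valuation\<close>

lemma integral_shift_periodic:
  fixes G :: "real \<Rightarrow> complex"
  assumes G: "continuous_on UNIV G" and per: "\<And>\<theta>. G (\<theta> + 1) = G \<theta>" and s: "0 \<le> s"
  shows "integral {0..1} (\<lambda>\<theta>. G (\<theta> + s)) = integral {0..1} G"
proof -
  have int: "G integrable_on {a..b}" for a b
    by (intro integrable_continuous_interval continuous_on_subset[OF G]) auto
  have sh: "integral {a..b} (\<lambda>\<theta>. G (\<theta> + t)) = integral {a+t..b+t} G" for a b t
    using integral_shift_real_ivl[of "a+t" t "b+t" G] by simp
  have "integral {0..s} G + integral {s..1+s} G = integral {0..1} G + integral {1..1+s} G"
    using s Henstock_Kurzweil_Integration.integral_combine[OF _ _ int, of 0 s "1 + s"]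
      Henstock_Kurzweil_Integration.integral_combine[OF _ _ int, of 0 1 "1 + s"] by simp
  moreover have "integral {1..1+s} G = integral {0..s} G"
    using sh[of 0 s 1] by (simp add: per add.commute)
  ultimately show ?thesis using sh[of 0 1 s] by simp
qed

lemma exp_int_period:
  "exp (2 * of_real pi * \<i> * of_int n * of_real (\<theta> + s)) =
     exp (2 * of_real pi * \<i> * of_int n * of_real \<theta>) * exp (2 * of_real pi * \<i> * of_real (of_int n * s))"
  by (simp add: ring_distribs exp_add[symmetric] mult_ac)

lemma trig_sum_shift:
  assumes "P > 0" and T: "\<And>n. n \<in> T \<Longrightarrow> P dvd n"
  shows "trig_sum T c (\<theta> + 1 / of_int P) = trig_sum T c \<theta>"
  unfolding trig_sum_def
proof (rule sum.cong)
  fix n assume "n \<in> T"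
  then obtain r where "n = P * r" using T by blast
  then have "real_of_int n * (1 / of_int P) = of_int r" using assms(1) by simp
  then have "exp (2 * of_real pi * \<i> * of_real (of_int n * (1 / of_int P))) = (1::complex)"
    by (simp only: of_real_of_int_eq) (simp add: exp_eq_1)
  then show "of_real (c n) * exp (2 * of_real pi * \<i> * of_int n * of_real (\<theta> + 1 / of_int P)) =
        of_real (c n) * exp (2 * of_real pi * \<i> * of_int n * of_real \<theta>)"
    unfolding exp_int_period by simp
qed simp

text \<open>A shift by \<open>1/P\<close> fixes the first factor and multiplies every exponential of the second one by a
  root of unity other than one, so the integral equals a nontrivial multiple of itself.\<close>

lemma integral_orthogonal:
  assumes P: "P > 0" and T: "\<And>n. n \<in> T \<Longrightarrow> P dvd n" and R: "\<And>n. n \<in> R \<Longrightarrow> \<not> P dvd n"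
    and fin: "finite R"
  shows "integral {0..1} (\<lambda>\<theta>. cmod (trig_sum T c \<theta>) ^ (2 * m) * Re (cnj (trig_sum T c \<theta>) * trig_sum R d \<theta>)) = 0"
proof -
  define h where "h = (\<lambda>\<theta>. of_real (cmod (trig_sum T c \<theta>) ^ (2 * m)) * cnj (trig_sum T c \<theta>))"
  have h: "continuous_on X h" for X
    unfolding h_def by (intro continuous_intros continuous_on_trig_sum)
  have hper: "h (\<theta> + 1 / of_int P) = h \<theta>" for \<theta>
    unfolding h_def by (simp add: trig_sum_shift[OF P T])
  have hper1: "h (\<theta> + 1) = h \<theta>" for \<theta>
    using trig_sum_shift[of 1 T c \<theta>] unfolding h_def by simp
  define E where "E = (\<lambda>n \<theta>. exp (2 * of_real pi * \<i> * of_int n * of_real \<theta>))"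
  have E: "continuous_on X (E n)" for X n
    unfolding E_def by (intro continuous_intros)
  have zero: "integral {0..1} (\<lambda>\<theta>. h \<theta> * E n \<theta>) = 0" if "n \<in> R" for n
  proof -
    define \<zeta> where "\<zeta> = exp (2 * of_real pi * \<i> * of_real (of_int n * (1 / of_int P)))"
    have "\<zeta> \<noteq> 1"
    proof
      assume "\<zeta> = 1"
      then obtain r :: int where "2 * pi * (of_int n * (1 / of_int P)) = of_int (2 * r) * pi"
        unfolding \<zeta>_def exp_eq_1 by auto
      then have "real_of_int n = of_int (r * P)" using P by (simp add: field_simps)
      then have "n = r * P" by (simp only: of_int_eq_iff)
      then show False using R[OF that] by simp
    qed
    have E1: "E n (\<theta> + 1) = E n \<theta>" for \<theta>
      unfolding E_def exp_int_period by (simp add: exp_eq_1)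
    have Es: "E n (\<theta> + 1 / of_int P) = E n \<theta> * \<zeta>" for \<theta>
      unfolding E_def \<zeta>_def by (rule exp_int_period)
    have "integral {0..1} (\<lambda>\<theta>. h \<theta> * E n \<theta>) = integral {0..1} (\<lambda>\<theta>. h (\<theta> + 1 / of_int P) * E n (\<theta> + 1 / of_int P))"
      by (rule integral_shift_periodic[symmetric]) (use P in \<open>auto intro!: continuous_intros h E simp: hper1 E1\<close>)
    also have "\<dots> = integral {0..1} (\<lambda>\<theta>. \<zeta> * (h \<theta> * E n \<theta>))"
      unfolding hper Es by (simp add: mult_ac)
    also have "\<dots> = \<zeta> * integral {0..1} (\<lambda>\<theta>. h \<theta> * E n \<theta>)" by simp
    finally show ?thesis using \<open>\<zeta> \<noteq> 1\<close> by simp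
  qed
  have ts: "trig_sum R d \<theta> = (\<Sum>n\<in>R. of_real (d n) * E n \<theta>)" for \<theta>
    by (simp add: trig_sum_def E_def)
  have "((\<lambda>\<theta>. \<Sum>n\<in>R. of_real (d n) * (h \<theta> * E n \<theta>)) has_integral (\<Sum>n\<in>R. of_real (d n) * 0)) {0..1}"
    by (intro has_integral_sum fin has_integral_mult_right)
       (metis zero integrable_integral integrable_continuous_interval continuous_on_mult h E)
  then have "((\<lambda>\<theta>. h \<theta> * trig_sum R d \<theta>) has_integral 0) {0..1}"
    by (simp add: ts sum_distrib_left mult.left_commute)
  then have "((\<lambda>\<theta>. Re (h \<theta> * trig_sum R d \<theta>)) has_integral 0) {0..1}"
    by (auto dest: has_integral_linear[OF _ bounded_linear_Re] simp: o_def)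
  moreover have "Re (h \<theta> * trig_sum R d \<theta>) = cmod (trig_sum T c \<theta>) ^ (2 * m) * Re (cnj (trig_sum T c \<theta>) * trig_sum R d \<theta>)" for \<theta>
    unfolding h_def mult.assoc by (simp only: scaleR_conv_of_real[symmetric] scaleR_complex.sel)
  ultimately show ?thesis by (simp add: integral_unique)
qed

text \<open>A Littlewood-Paley inequality for the \<open>p\<close>-adic filtration. The pieces are added in the order of
  decreasing valuation: when the piece of valuation \<open>b\<close> is added, the frequencies present so far are
  divisible by \<open>p\<^sup>b\<^sup>+\<^sup>1\<close> and the new ones are not, which makes the two parts orthogonal in the sense
  required.\<close>

lemma moment_valuation_split:
  "\<exists>D\<ge>1. \<forall>p S c \<beta>. prime (p::nat) \<longrightarrow> finite S \<longrightarrow> 0 \<notin> S \<longrightarrow>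
     (\<forall>j. \<beta> j \<ge> 0 \<and> moment (Suc m) (trig_sum {n\<in>S. multiplicity p (nat \<bar>n\<bar>) = j} c) \<le> \<beta> j ^ Suc m) \<longrightarrow>
     moment (Suc m) (trig_sum S c) \<le> (D * (\<Sum>j\<in>(\<lambda>n. multiplicity p (nat \<bar>n\<bar>)) ` S. \<beta> j)) ^ Suc m"
proof -
  obtain D :: real where D: "D \<ge> 1" and add: "\<And>f g \<alpha> \<beta>. continuous_on {0..1} f \<Longrightarrow> continuous_on {0..1} g \<Longrightarrow> \<alpha> \<ge> 0 \<Longrightarrow> \<beta> \<ge> 0 \<Longrightarrow>
     moment (Suc m) f \<le> \<alpha> ^ Suc m \<Longrightarrow> moment (Suc m) g \<le> \<beta> ^ Suc m \<Longrightarrow>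
     integral {0..1} (\<lambda>\<theta>. cmod (f \<theta>) ^ (2 * m) * Re (cnj (f \<theta>) * g \<theta>)) = 0 \<Longrightarrow>
     moment (Suc m) (\<lambda>\<theta>. f \<theta> + g \<theta>) \<le> (\<alpha> + D * \<beta>) ^ Suc m"
    using moment_add_orthogonal_le[of m] by blast
  have main: "moment (Suc m) (trig_sum S c) \<le> (D * (\<Sum>j\<in>(\<lambda>n. multiplicity p (nat \<bar>n\<bar>)) ` S. \<beta> j)) ^ Suc m"
    if p: "prime p" and S: "finite S" "0 \<notin> S"
      and \<beta>: "\<And>j. \<beta> j \<ge> 0" "\<And>j. moment (Suc m) (trig_sum {n\<in>S. multiplicity p (nat \<bar>n\<bar>) = j} c) \<le> \<beta> j ^ Suc m"
    for p :: nat and S c \<beta>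
  proof -
    define v where "v = (\<lambda>n. multiplicity p (nat \<bar>n\<bar>))"
    have dvd: "int (p ^ j) dvd n \<longleftrightarrow> j \<le> v n" if "n \<in> S" for j n
    proof -
      have "n \<noteq> 0" using S that by auto
      then have "p ^ j dvd nat \<bar>n\<bar> \<longleftrightarrow> j \<le> v n" unfolding v_def
        using p by (intro power_dvd_iff_le_multiplicity) (auto simp: prime_gt_1_nat)
      then show ?thesis by (simp only: int_dvd_int_iff[symmetric]) simp
    qed
    have "moment (Suc m) (trig_sum {n\<in>S. v n \<in> J} c) \<le> (D * sum \<beta> J) ^ Suc m" if "finite J" for J
      using that
    proof (induction rule: finite_linorder_min_induct)
      case empty
      then show ?case by (simp add: trig_sum_def moment_def)
    next
      case (insert b J)
      have "b \<notin> J" using insert by auto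
      let ?f = "trig_sum {n\<in>S. v n \<in> J} c" and ?g = "trig_sum {n\<in>S. v n = b} c"
      have "moment (Suc m) (\<lambda>\<theta>. ?f \<theta> + ?g \<theta>) \<le> (D * sum \<beta> J + D * \<beta> b) ^ Suc m"
      proof (rule add)
        show "integral {0..1} (\<lambda>\<theta>. cmod (?f \<theta>) ^ (2 * m) * Re (cnj (?f \<theta>) * ?g \<theta>)) = 0"
        proof (rule integral_orthogonal[where P = "int (p ^ Suc b)"])
          show "int (p ^ Suc b) dvd n" if "n \<in> {n \<in> S. v n \<in> J}" for n
            using that insert.hyps dvd[of n "Suc b"] by auto
          show "\<not> int (p ^ Suc b) dvd n" if "n \<in> {n \<in> S. v n = b}" for n
            using that dvd[of n "Suc b"] by auto
        qed (use p S in \<open>auto simp: prime_gt_0_nat\<close>)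
        show "moment (Suc m) ?f \<le> (D * sum \<beta> J) ^ Suc m" by (rule insert.IH)
        show "moment (Suc m) ?g \<le> \<beta> b ^ Suc m" using \<beta>(2)[of b] by (simp add: v_def)
      qed (use D \<beta> in \<open>auto intro!: continuous_on_trig_sum sum_nonneg mult_nonneg_nonneg\<close>)
      also have "(\<lambda>\<theta>. ?f \<theta> + ?g \<theta>) = trig_sum {n\<in>S. v n \<in> insert b J} c"
      proof -
        have "{n\<in>S. v n \<in> insert b J} = {n\<in>S. v n \<in> J} \<union> {n\<in>S. v n = b}" by auto
        then show ?thesis
          using S \<open>b \<notin> J\<close> unfolding trig_sum_def by (subst sum.union_disjoint[symmetric]) auto
      qed
      also have "D * sum \<beta> J + D * \<beta> b = D * sum \<beta> (insert b J)"
        using insert.hyps \<open>b \<notin> J\<close> by (simp add: algebra_simps)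
      finally show ?case .
    qed
    from this[of "v ` S"] S have "moment (Suc m) (trig_sum {n\<in>S. v n \<in> v ` S} c) \<le> (D * sum \<beta> (v ` S)) ^ Suc m"
      by blast
    moreover have "{n\<in>S. v n \<in> v ` S} = S" by auto
    ultimately show ?thesis by (simp only: v_def)
  qed
  show ?thesis
    by (intro exI[of _ D] conjI allI impI D main) simp_all
qed

section \<open>Weights found by querying valuations\<close>

text \<open>The inequality holds for the frequency \<open>n\<close> placed at the point \<open>x/|n|\<close> of the weighted set, for
  every \<open>x\<close> at once: in terms of valuations this is a reflection followed by a translation, and a
  procedure that queries valuations works as well after such a change. The factor \<open>2\<close> accounts for
  \<open>n\<close> and \<open>-n\<close> sharing a point.\<close>

definition dominating :: "nat \<Rightarrow> (nat \<Rightarrow> real) \<Rightarrow> bool" where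
  "dominating k w \<longleftrightarrow> (\<forall>x S c. x > 0 \<longrightarrow> finite S \<longrightarrow>
     (\<forall>n\<in>S. n \<noteq> 0 \<and> nat \<bar>n\<bar> dvd x \<and> w (x div nat \<bar>n\<bar>) > 0) \<longrightarrow>
     moment k (trig_sum S c) \<le> (\<Sum>n\<in>S. 2 * (c n)\<^sup>2 / w (x div nat \<bar>n\<bar>)) ^ k)"

lemma dominatingD:
  assumes "dominating k w" "x > 0" "finite S"
    "\<And>n. n \<in> S \<Longrightarrow> n \<noteq> 0 \<and> nat \<bar>n\<bar> dvd x \<and> w (x div nat \<bar>n\<bar>) > 0"
  shows "moment k (trig_sum S c) \<le> (\<Sum>n\<in>S. 2 * (c n)\<^sup>2 / w (x div nat \<bar>n\<bar>)) ^ k"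
  using assms unfolding dominating_def by blast

lemma cmod_trig_sum_le: "cmod (trig_sum S c \<theta>) \<le> (\<Sum>n\<in>S. \<bar>c n\<bar>)"
proof -
  have "cmod (exp (2 * of_real pi * \<i> * of_int n * of_real \<theta>)) = 1" for n
    by (simp add: norm_exp_eq_Re)
  then show ?thesis unfolding trig_sum_def
    by (intro order_trans[OF norm_sum]) (simp add: norm_mult)
qed

lemma moment_le_card:
  assumes "finite S" "real (card S) \<le> r"
  shows "moment k (trig_sum S c) \<le> (\<Sum>n\<in>S. r * (c n)\<^sup>2) ^ k"
proof -
  have pt: "cmod (trig_sum S c \<theta>) ^ (2 * k) \<le> (\<Sum>n\<in>S. r * (c n)\<^sup>2) ^ k" for \<theta>
  proof -
    have "(cmod (trig_sum S c \<theta>))\<^sup>2 \<le> (\<Sum>n\<in>S. \<bar>c n\<bar> * 1)\<^sup>2"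
      using cmod_trig_sum_le[of S c \<theta>] by (intro power_mono) auto
    also have "\<dots> \<le> (\<Sum>n\<in>S. \<bar>c n\<bar>\<^sup>2) * (\<Sum>n\<in>S. 1\<^sup>2)"
      by (rule Cauchy_Schwarz_ineq_sum)
    also have "\<dots> \<le> (\<Sum>n\<in>S. \<bar>c n\<bar>\<^sup>2) * r"
      using assms by (intro mult_left_mono sum_nonneg) auto
    finally have "(cmod (trig_sum S c \<theta>))\<^sup>2 \<le> (\<Sum>n\<in>S. r * (c n)\<^sup>2)"
      by (simp add: sum_distrib_right sum_distrib_left mult.commute)
    then show ?thesis unfolding power_mult by (intro power_mono) auto
  qed
  have "moment k (trig_sum S c) \<le> integral {0..1::real} (\<lambda>_. (\<Sum>n\<in>S. r * (c n)\<^sup>2) ^ k)"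
    unfolding moment_def
    by (intro integral_le integrable_continuous_interval continuous_intros continuous_on_trig_sum pt)
  then show ?thesis by simp
qed

lemma dominating_indicator:
  assumes "a > 0"
  shows "dominating k (indicator {a})"
  unfolding dominating_def
proof (intro allI impI)
  fix x :: nat and S :: "int set" and c :: "int \<Rightarrow> real"
  assume x: "x > 0" and S: "finite S"
    and *: "\<forall>n\<in>S. n \<noteq> 0 \<and> nat \<bar>n\<bar> dvd x \<and> (indicator {a} (x div nat \<bar>n\<bar>) :: real) > 0"
  then have a: "x div nat \<bar>n\<bar> = a" if "n \<in> S" for n
    using that by (auto simp: indicator_def split: if_splits)
  have "nat \<bar>n\<bar> = x div a" if "n \<in> S" for n
  proof -
    have "x = nat \<bar>n\<bar> * a" using a[OF that] * that by fastforce
    then show ?thesis using assms by simp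
  qed
  then have "S \<subseteq> {int (x div a), - int (x div a)}" by fastforce
  then have "card S \<le> card {int (x div a), - int (x div a)}"
    by (intro card_mono) auto
  also have "\<dots> \<le> 2" by (simp add: card_insert_if)
  finally have "moment k (trig_sum S c) \<le> (\<Sum>n\<in>S. 2 * (c n)\<^sup>2) ^ k"
    using S by (intro moment_le_card) auto
  also have "(\<Sum>n\<in>S. 2 * (c n)\<^sup>2) = (\<Sum>n\<in>S. 2 * (c n)\<^sup>2 / indicator {a} (x div nat \<bar>n\<bar>))"
    using a by (intro sum.cong) auto
  finally show "moment k (trig_sum S c) \<le> (\<Sum>n\<in>S. 2 * (c n)\<^sup>2 / indicator {a} (x div nat \<bar>n\<bar>)) ^ k" .
qed

text \<open>Querying the valuation at \<open>p\<close> splits a sum into pieces, each of which is controlled by the weight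
  belonging to the answer; recombining the pieces costs the factor \<open>D\<close>. For a fixed \<open>x\<close> the valuations
  of \<open>n\<close> and of \<open>x/|n|\<close> determine each other, so that grouping by either is the same.\<close>

lemma dominating_query:
  "\<exists>D\<ge>1. \<forall>p w. prime p \<longrightarrow> (\<forall>j. dominating (Suc m) (w j)) \<longrightarrow>
      dominating (Suc m) (\<lambda>n. w (multiplicity p n) n / D)"
proof -
  obtain D :: real where D: "D \<ge> 1" and split: "\<And>(p::nat) S c \<beta>. prime p \<Longrightarrow> finite S \<Longrightarrow> 0 \<notin> S \<Longrightarrow>
     (\<And>j. \<beta> j \<ge> 0) \<Longrightarrow> (\<And>j. moment (Suc m) (trig_sum {n\<in>S. multiplicity p (nat \<bar>n\<bar>) = j} c) \<le> \<beta> j ^ Suc m) \<Longrightarrow>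
     moment (Suc m) (trig_sum S c) \<le> (D * (\<Sum>j\<in>(\<lambda>n. multiplicity p (nat \<bar>n\<bar>)) ` S. \<beta> j)) ^ Suc m"
    by (rule exE[OF moment_valuation_split[of m]], elim conjE, rule that, assumption, simp del: power_Suc)
  have main: "dominating (Suc m) (\<lambda>n. w (multiplicity p n) n / D)"
    if p: "prime p" and w: "\<And>j. dominating (Suc m) (w j)" for p w
    unfolding dominating_def
  proof (intro allI impI)
    fix x :: nat and S :: "int set" and c :: "int \<Rightarrow> real"
    assume x: "x > 0" and S: "finite S"
      and *: "\<forall>n\<in>S. n \<noteq> 0 \<and> nat \<bar>n\<bar> dvd x \<and> w (multiplicity p (x div nat \<bar>n\<bar>)) (x div nat \<bar>n\<bar>) / D > 0"
    define v where "v = (\<lambda>n. multiplicity p (nat \<bar>n\<bar>))"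
    define u where "u = (\<lambda>j. w (multiplicity p x - j))"
    have wu: "dominating (Suc m) (u j)" for j unfolding u_def by (rule w)
    have mult: "multiplicity p (x div nat \<bar>n\<bar>) = multiplicity p x - v n" if "n \<in> S" for n
    proof -
      obtain y where y: "x = nat \<bar>n\<bar> * y" using * \<open>n \<in> S\<close> by blast
      then have "multiplicity p x = v n + multiplicity p y"
        unfolding v_def y using p x y by (intro prime_elem_multiplicity_mult_distrib) (auto intro!: Nat.gr0I)
      then show ?thesis using x y by simp
    qed
    have pos: "u (v n) (x div nat \<bar>n\<bar>) > 0" if "n \<in> S" for n
      using * that D mult[OF that] by (force simp: u_def zero_less_divide_iff)
    define \<beta> where "\<beta> = (\<lambda>j. \<Sum>n\<in>{n\<in>S. v n = j}. 2 * (c n)\<^sup>2 / u j (x div nat \<bar>n\<bar>))"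
    have "moment (Suc m) (trig_sum S c) \<le> (D * (\<Sum>j\<in>v ` S. \<beta> j)) ^ Suc m"
      unfolding v_def
    proof (rule split)
      show "0 \<notin> S" using * by auto
      show "\<beta> j \<ge> 0" for j
        unfolding \<beta>_def using pos by (intro sum_nonneg) (auto intro!: divide_nonneg_pos)
      show "moment (Suc m) (trig_sum {n\<in>S. multiplicity p (nat \<bar>n\<bar>) = j} c) \<le> \<beta> j ^ Suc m" for j
        unfolding \<beta>_def v_def
        by (rule dominatingD[OF wu x])
           (use S * pos in \<open>auto simp: v_def\<close>)
    qed (use p S in auto)
    also have "(\<Sum>j\<in>v ` S. \<beta> j) = (\<Sum>j\<in>v ` S. \<Sum>n\<in>{n\<in>S. v n = j}. 2 * (c n)\<^sup>2 / u (v n) (x div nat \<bar>n\<bar>))"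
      unfolding \<beta>_def by (intro sum.cong) auto
    also have "\<dots> = (\<Sum>n\<in>S. 2 * (c n)\<^sup>2 / u (v n) (x div nat \<bar>n\<bar>))"
      using S by (intro sum.group) auto
    also have "D * \<dots> = (\<Sum>n\<in>S. 2 * (c n)\<^sup>2 / (w (multiplicity p (x div nat \<bar>n\<bar>)) (x div nat \<bar>n\<bar>) / D))"
      unfolding sum_distrib_left by (intro sum.cong) (auto simp: mult u_def)
    finally show "moment (Suc m) (trig_sum S c) \<le>
       (\<Sum>n\<in>S. 2 * (c n)\<^sup>2 / (w (multiplicity p (x div nat \<bar>n\<bar>)) (x div nat \<bar>n\<bar>) / D)) ^ Suc m" .
  qed
  show ?thesis
    by (intro exI[of _ D] conjI allI impI D main) simp_all
qed

lemma dominating_zero: "dominating (Suc m) (\<lambda>_. 0)"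
proof -
  have "moment (Suc m) (trig_sum {} c) = 0" for c
    by (simp add: moment_def trig_sum_def)
  then show ?thesis unfolding dominating_def by (metis (no_types, lifting) all_not_in_conv less_irrefl order_refl sum.empty power_Suc mult_zero_left)
qed

text \<open>Every frequency \<open>n\<close> meets each point \<open>b \<in> B\<close> exactly once as \<open>b = x/|n|\<close>, namely for \<open>x = |n|b\<close>,
  which lies in \<open>BB\<close>. Therefore \<open>W\<close> times the sum is the sum over \<open>x \<in> BB\<close> of the sums with
  coefficients multiplied by \<open>w (x/|n|)\<close>. The squared bounds of these \<open>|BB|\<close> sums add up to at
  most \<open>2W\<close>, and the Cauchy-Schwarz inequality bounds the sum of the norms.\<close>

lemma moment_le_of_dominating:
  fixes B :: "nat set"
  assumes w: "dominating k w" "\<And>b. b \<in> B \<Longrightarrow> w b \<ge> 0" and W: "sum w B > 0"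
    and B: "finite B" "0 \<notin> B" and k: "k > 0"
    and S: "finite S" "\<And>n. n \<in> S \<Longrightarrow> nat \<bar>n\<bar> \<in> B" and c: "(\<Sum>n\<in>S. (c n)\<^sup>2) \<le> 1"
    and supp: "\<And>b. b \<notin> B \<Longrightarrow> w b = 0"
  shows "moment k (trig_sum S c) \<le> (2 * real (card (B * B)) / sum w B) ^ k"
proof -
  define X W where "X = B * B" and "W = sum w B"
  have W0: "W > 0" using W by (simp add: W_def)
  have X: "finite X" unfolding X_def using B by (intro finite_set_times)
  have X0: "x > 0" if "x \<in> X" for x
    using that B unfolding X_def by (auto elim!: set_times_elim intro!: Nat.gr0I)
  define Q where "Q = (\<lambda>n x. nat \<bar>n\<bar> dvd x \<and> w (x div nat \<bar>n\<bar>) > 0)"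
  have total: "(\<Sum>x\<in>{x\<in>X. Q n x}. w (x div nat \<bar>n\<bar>)) = W" if "n \<in> S" for n
  proof -
    have n: "nat \<bar>n\<bar> \<in> B" "nat \<bar>n\<bar> > 0" using S(2)[OF that] B by (auto intro!: Nat.gr0I)
    have inB: "b \<in> B" if "w b > 0" for b using supp[of b] that by (cases "b \<in> B") auto
    have "(\<Sum>x\<in>{x\<in>X. Q n x}. w (x div nat \<bar>n\<bar>)) = (\<Sum>b\<in>{b\<in>B. w b > 0}. w b)"
      by (rule sum.reindex_bij_witness[of _ "\<lambda>b. nat \<bar>n\<bar> * b" "\<lambda>x. x div nat \<bar>n\<bar>"])
         (use n inB in \<open>auto simp: Q_def X_def set_times_intro dvd_def\<close>)
    also have "\<dots> = W"
      unfolding W_def using B w(2) by (intro sum.mono_neutral_left) force+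
    finally show ?thesis .
  qed
  define Sx where "Sx = (\<lambda>x. {n\<in>S. Q n x})"
  define d where "d = (\<lambda>x n. c n * w (x div nat \<bar>n\<bar>) / W)"
  define \<beta> where "\<beta> = (\<lambda>x. \<Sum>n\<in>Sx x. 2 * (c n)\<^sup>2 * w (x div nat \<bar>n\<bar>) / W\<^sup>2)"
  have \<beta>0: "\<beta> x \<ge> 0" for x
    unfolding \<beta>_def Sx_def Q_def by (intro sum_nonneg) auto
  have decomp: "trig_sum S c \<theta> = (\<Sum>x\<in>X. trig_sum (Sx x) (d x) \<theta>)" for \<theta>
  proof -
    define e where "e = (\<lambda>n. exp (2 * of_real pi * \<i> * of_int n * of_real \<theta>))"
    have "(\<Sum>x\<in>X. trig_sum (Sx x) (d x) \<theta>) = (\<Sum>n\<in>S. \<Sum>x\<in>{x\<in>X. Q n x}. of_real (d x n) * e n)"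
      unfolding trig_sum_def Sx_def e_def by (rule sum.swap_restrict[OF X S(1)])
    also have "\<dots> = (\<Sum>n\<in>S. of_real (c n) * e n)"
    proof (rule sum.cong)
      fix n assume n: "n \<in> S"
      have "(\<Sum>x\<in>{x\<in>X. Q n x}. of_real (d x n) * e n) = of_real (c n * (\<Sum>x\<in>{x\<in>X. Q n x}. w (x div nat \<bar>n\<bar>)) / W) * e n"
        unfolding d_def by (simp add: sum_distrib_left sum_distrib_right sum_divide_distrib)
      then show "(\<Sum>x\<in>{x\<in>X. Q n x}. of_real (d x n) * e n) = of_real (c n) * e n"
        using W0 by (simp add: total[OF n])
    qed simp
    finally show ?thesis by (simp add: trig_sum_def e_def)
  qed
  have piece: "moment k (trig_sum (Sx x) (d x)) \<le> sqrt (\<beta> x) ^ (2 * k)" if "x \<in> X" for x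
  proof -
    have "moment k (trig_sum (Sx x) (d x)) \<le> (\<Sum>n\<in>Sx x. 2 * (d x n)\<^sup>2 / w (x div nat \<bar>n\<bar>)) ^ k"
      by (rule dominatingD[OF w(1) X0[OF that]]) (use S B in \<open>force simp: Sx_def Q_def\<close>)+
    also have "(\<Sum>n\<in>Sx x. 2 * (d x n)\<^sup>2 / w (x div nat \<bar>n\<bar>)) = \<beta> x"
      unfolding \<beta>_def d_def by (intro sum.cong) (auto simp: Sx_def Q_def power2_eq_square)
    finally show ?thesis using \<beta>0 by (simp add: power_mult)
  qed
  have "moment k (trig_sum S c) = moment k (\<lambda>\<theta>. \<Sum>x\<in>X. trig_sum (Sx x) (d x) \<theta>)"
    by (simp add: decomp[abs_def])
  also have "\<dots> \<le> (\<Sum>x\<in>X. sqrt (\<beta> x)) ^ (2 * k)"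
    by (rule moment_sum_le) (use X \<beta>0 k piece in \<open>auto intro: continuous_on_trig_sum\<close>)
  also have "\<dots> = ((\<Sum>x\<in>X. sqrt (\<beta> x) * 1)\<^sup>2) ^ k" by (simp add: power_mult)
  also have "\<dots> \<le> ((\<Sum>x\<in>X. (sqrt (\<beta> x))\<^sup>2) * (\<Sum>x\<in>X. 1\<^sup>2)) ^ k"
    by (intro power_mono Cauchy_Schwarz_ineq_sum) auto
  also have "(\<Sum>x\<in>X. (sqrt (\<beta> x))\<^sup>2) = (\<Sum>x\<in>X. \<beta> x)" using \<beta>0 by simp
  also have "(\<Sum>x\<in>X. \<beta> x) = (\<Sum>n\<in>S. \<Sum>x\<in>{x\<in>X. Q n x}. 2 * (c n)\<^sup>2 * w (x div nat \<bar>n\<bar>) / W\<^sup>2)"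
    unfolding \<beta>_def Sx_def by (rule sum.swap_restrict[OF X S(1)])
  also have "\<dots> = (\<Sum>n\<in>S. 2 * (c n)\<^sup>2 / W)"
  proof (rule sum.cong)
    fix n assume n: "n \<in> S"
    have "(\<Sum>x\<in>{x\<in>X. Q n x}. 2 * (c n)\<^sup>2 * w (x div nat \<bar>n\<bar>) / W\<^sup>2) = 2 * (c n)\<^sup>2 * (\<Sum>x\<in>{x\<in>X. Q n x}. w (x div nat \<bar>n\<bar>)) / W\<^sup>2"
      by (simp add: sum_distrib_left sum_divide_distrib)
    then show "(\<Sum>x\<in>{x\<in>X. Q n x}. 2 * (c n)\<^sup>2 * w (x div nat \<bar>n\<bar>) / W\<^sup>2) = 2 * (c n)\<^sup>2 / W"
      using W0 by (simp add: total[OF n] power2_eq_square)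
  qed simp
  also have "\<dots> = 2 / W * (\<Sum>n\<in>S. (c n)\<^sup>2)"
    by (simp add: sum_distrib_left sum_divide_distrib)
  also have "(2 / W * (\<Sum>n\<in>S. (c n)\<^sup>2) * (\<Sum>x\<in>X. 1\<^sup>2)) ^ k \<le> (2 / W * 1 * (\<Sum>x\<in>X. 1\<^sup>2)) ^ k"
    using W0 c by (intro power_mono mult_right_mono mult_left_mono) (auto intro!: divide_nonneg_nonneg mult_nonneg_nonneg sum_nonneg simp: less_imp_le)
  finally show ?thesis by (simp add: X_def W_def)
qed

section \<open>Inequalities behind the growth of product sets\<close>

lemma Holder_sum:
  fixes a b :: "'i \<Rightarrow> real"
  assumes X: "finite X" "X \<noteq> {}" and pos: "\<And>i. i \<in> X \<Longrightarrow> a i > 0" "\<And>i. i \<in> X \<Longrightarrow> b i > 0"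
    and t: "0 \<le> s" "0 \<le> t" "s + t = 1"
  shows "(\<Sum>i\<in>X. a i powr s * b i powr t) \<le> sum a X powr s * sum b X powr t"
proof -
  have A: "sum a X > 0" "sum b X > 0" using X pos by (auto intro!: sum_pos)
  have "(\<Sum>i\<in>X. a i powr s * b i powr t) = sum a X powr s * sum b X powr t * (\<Sum>i\<in>X. (a i / sum a X) powr s * (b i / sum b X) powr t)"
    unfolding sum_distrib_left using A pos by (intro sum.cong) (auto simp: powr_divide less_imp_le)
  also have "(\<Sum>i\<in>X. (a i / sum a X) powr s * (b i / sum b X) powr t) \<le> (\<Sum>i\<in>X. s * (a i / sum a X) + t * (b i / sum b X))"
    using A pos t by (intro sum_mono Youngs_inequality_0) auto
  also have "\<dots> = s * (sum a X / sum a X) + t * (sum b X / sum b X)"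
    by (simp only: sum.distrib sum_distrib_left[symmetric] sum_divide_distrib[symmetric])
  also have "\<dots> = 1" using A t by simp
  finally show ?thesis by (simp add: mult_left_mono)
qed

text \<open>The numerical core of the induction. Here \<open>x\<close> runs over the values of one valuation, \<open>n x\<close> is the
  size of a fibre, \<open>W x\<close> its best total weight, and \<open>(u x)\<^sup>2\<close> its potential. The right-hand side is the
  factor that the set contributes to the lower bound for the squared size of a product set. The
  left-hand side is the potential of the whole set, whose
  best weight \<open>V\<close> is at least what one fibre and what a query provides.

  Put \<open>U = u x0\<close>. If \<open>U (\<Sum>u) - U\<^sup>2\<close> is not small compared with \<open>\<Sum>u\<^sup>2\<close>, the right-hand side is at least \<open>5/4\<close>
  times \<open>\<Sum>u\<^sup>2\<close>, which pays for the loss \<open>D\<^sup>e\<close> of a query. Otherwise the fibre over \<open>x0\<close> carries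
  at least half of \<open>\<Sum>u\<close>, and the best single fibre suffices.\<close>

lemma gain_inequality:
  fixes n W u :: "'i \<Rightarrow> real"
  assumes X: "finite X" and x0: "x0 \<in> X" and n: "\<And>x. x \<in> X \<Longrightarrow> n x > 0" and W: "\<And>x. x \<in> X \<Longrightarrow> W x > 0"
    and u: "\<And>x. x \<in> X \<Longrightarrow> u x > 0" "\<And>x. x \<in> X \<Longrightarrow> (u x)\<^sup>2 = n x powr (1 + e) * W x powr (- e)"
    and U: "\<And>x. x \<in> X \<Longrightarrow> u x \<le> u x0"
    and V: "\<And>x. x \<in> X \<Longrightarrow> W x \<le> V" "sum W X / D \<le> V"
    and e: "0 < e" "e \<le> 1/8" and D: "D > 0" "D powr e \<le> 5/4"
  shows "sum n X powr (1 + e) * V powr (- e) \<le> u x0 * sum u X / 2 + (\<Sum>x\<in>X. (u x)\<^sup>2) - (u x0)\<^sup>2 / 2"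
proof -
  define U Q S where "U = u x0" and "Q = (\<Sum>x\<in>X. (u x)\<^sup>2)" and "S = sum u X"
  have X0: "X \<noteq> {}" using x0 by auto
  have U0: "U > 0" unfolding U_def using u x0 by auto
  have V0: "V > 0" using V(1)[OF x0] W[OF x0] by linarith
  have Q0: "Q > 0" unfolding Q_def using X X0 u(1) by (intro sum_pos) (auto simp: less_imp_neq[symmetric])
  have N0: "sum n X > 0" using X X0 n by (intro sum_pos) auto
  have SW0: "sum W X > 0" using X X0 W by (intro sum_pos) auto
  have ee: "1 / (1 + e) \<ge> 0" "e / (1 + e) \<ge> 0" "1 / (1 + e) + e / (1 + e) = 1"
    using e by (auto simp: field_simps)
  \<comment> \<open>exponents \<open>1/(1+e)\<close> and \<open>e/(1+e)\<close> recover \<open>n x\<close> from potential and weight\<close>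
  have n_eq: "n x = (u x)\<^sup>2 powr (1 / (1 + e)) * W x powr (e / (1 + e))" if "x \<in> X" for x
  proof -
    have "(u x)\<^sup>2 powr (1 / (1 + e)) * W x powr (e / (1 + e)) = n x powr 1 * (W x powr (- e / (1 + e)) * W x powr (e / (1 + e)))"
      unfolding u(2)[OF that] using n[OF that] W[OF that] e by (simp add: powr_mult powr_powr)
    also have "\<dots> = n x" using n[OF that] W[OF that] by (simp add: powr_minus_divide)
    finally show ?thesis ..
  qed
  show ?thesis
  proof (cases "U * S / 2 - U\<^sup>2 / 2 \<ge> Q / 4")
    case True
    \<comment> \<open>the set is queried: the weights of all fibres are summed by Hoelder's inequality\<close>
    have "sum n X = (\<Sum>x\<in>X. (u x)\<^sup>2 powr (1 / (1 + e)) * W x powr (e / (1 + e)))"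
      using n_eq by (rule sum.cong[OF refl])
    also have "\<dots> \<le> Q powr (1 / (1 + e)) * sum W X powr (e / (1 + e))"
      unfolding Q_def using X X0 u(1) W ee by (intro Holder_sum) (auto simp: less_imp_neq[symmetric])
    finally have "sum n X powr (1 + e) \<le> (Q powr (1 / (1 + e)) * sum W X powr (e / (1 + e))) powr (1 + e)"
      using N0 e by (intro powr_mono2) auto
    also have "\<dots> = Q * sum W X powr e"
      using Q0 SW0 e by (simp add: powr_mult powr_powr)
    also have "\<dots> \<le> Q * (D * V) powr e"
      using Q0 SW0 e D V(2) by (intro mult_left_mono powr_mono2) (auto simp: field_simps)
    also have "\<dots> = Q * D powr e * V powr e"
      using D V0 by (simp add: powr_mult)
    finally have "sum n X powr (1 + e) * V powr (- e) \<le> Q * D powr e * V powr e * V powr (- e)"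
      by (rule mult_right_mono) simp
    also have "\<dots> = Q * D powr e" using V0 by (simp add: powr_minus)
    also have "\<dots> \<le> Q * (5/4)" using Q0 D by (intro mult_left_mono) auto
    finally show ?thesis using True unfolding Q_def S_def U_def by linarith
  next
    case False
    \<comment> \<open>one fibre dominates: the remaining scaled values add up to at most one, and no query is made\<close>
    define s where "s = (\<lambda>x. u x / U)"
    have s: "0 < s x" "s x \<le> 1" if "x \<in> X" for x
      using u(1)[OF that] U[OF that] U0 by (auto simp: s_def U_def)
    have s0: "s x0 = 1" using U0 by (simp add: s_def U_def)
    define S' Q' where "S' = (\<Sum>x\<in>X - {x0}. s x)" and "Q' = (\<Sum>x\<in>X - {x0}. (s x)\<^sup>2)"
    have SS: "S = U * (1 + S')"
    proof -
      have "S = U * sum s X" using U0 by (simp add: S_def s_def sum_distrib_left)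
      then show ?thesis using sum.remove[OF X x0, of s] s0 by (simp add: S'_def)
    qed
    have QQ: "Q = U\<^sup>2 * (1 + Q')"
    proof -
      have "Q = U\<^sup>2 * (\<Sum>x\<in>X. (s x)\<^sup>2)"
        using U0 by (simp add: Q_def s_def sum_distrib_left power_divide)
      then show ?thesis using sum.remove[OF X x0, of "\<lambda>x. (s x)\<^sup>2"] s0 by (simp add: Q'_def)
    qed
    have Q'0: "Q' \<ge> 0" unfolding Q'_def by (intro sum_nonneg) auto
    have QS: "Q' \<le> S'"
      unfolding Q'_def S'_def using s by (intro sum_mono) (auto simp: power2_eq_square mult_left_le less_imp_le)
    have S1: "S' \<le> 1"
    proof -
      have "U\<^sup>2 * (S' / 2) < U\<^sup>2 * ((1 + Q') / 4)"
        using False unfolding SS QQ by (simp add: power2_eq_square algebra_simps)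
      then have "S' / 2 < (1 + Q') / 4" using U0 by (simp add: mult_less_cancel_left_pos)
      then show ?thesis using QS by simp
    qed
    define p where "p = 2 / (1 + e)"
    have pe: "p * (1 + e) = 2" using e by (simp add: p_def divide_simps)
    have p1: "p - 1 = (1 - e) / (1 + e)" "2 - p = 2 * e / (1 + e)"
      using e by (auto simp: p_def field_simps)
    define T where "T = (\<Sum>x\<in>X - {x0}. s x powr p)"
    have T0: "T \<ge> 0" unfolding T_def by (intro sum_nonneg) auto
    \<comment> \<open>\<open>p\<close> lies between 1 and 2, so \<open>s\<^sup>p\<close> interpolates between \<open>s\<close> and \<open>s\<^sup>2\<close>\<close>
    have T_le: "T \<le> (p - 1) * Q' + (2 - p) * S'"
      unfolding T_def Q'_def S'_def sum_distrib_left sum.distrib[symmetric]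
    proof (rule sum_mono)
      fix x assume "x \<in> X - {x0}"
      then have sx: "s x > 0" using s by auto
      have "((s x)\<^sup>2) powr (p - 1) * s x powr (2 - p) \<le> (p - 1) * (s x)\<^sup>2 + (2 - p) * s x"
        using sx e p1 by (intro Youngs_inequality_0) auto
      also have "((s x)\<^sup>2) powr (p - 1) * s x powr (2 - p) = s x powr (2 * (p - 1) + (2 - p))"
        using sx by (simp add: powr_powr flip: powr_numeral powr_add)
      finally show "s x powr p \<le> (p - 1) * (s x)\<^sup>2 + (2 - p) * s x" by simp
    qed
    have "(p - 1) * Q' \<le> (p - 1) * S'" using QS p1 e by (intro mult_left_mono) auto
    then have T1: "T \<le> 1" using T_le S1 by (simp add: algebra_simps)
    have "sum n X = (\<Sum>x\<in>X. (u x)\<^sup>2 powr (1 / (1 + e)) * W x powr (e / (1 + e)))"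
      using n_eq by (rule sum.cong[OF refl])
    also have "\<dots> \<le> (\<Sum>x\<in>X. (u x)\<^sup>2 powr (1 / (1 + e)) * V powr (e / (1 + e)))"
      using W V e by (intro sum_mono mult_left_mono powr_mono2) (auto simp: less_imp_le)
    also have "\<dots> = (\<Sum>x\<in>X. U powr p * s x powr p) * V powr (e / (1 + e))"
    proof -
      have "(u x)\<^sup>2 powr (1 / (1 + e)) = U powr p * s x powr p" if "x \<in> X" for x
        using u(1)[OF that] U0 by (simp add: s_def p_def powr_divide powr_powr flip: powr_numeral)
      then show ?thesis by (simp add: sum_distrib_right)
    qed
    also have "(\<Sum>x\<in>X. U powr p * s x powr p) = U powr p * (1 + T)"
      using sum.remove[OF X x0, of "\<lambda>x. s x powr p"] s0 by (simp add: T_def flip: sum_distrib_left)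
    finally have "sum n X powr (1 + e) \<le> (U powr p * (1 + T) * V powr (e / (1 + e))) powr (1 + e)"
      using N0 e by (intro powr_mono2) auto
    also have "\<dots> = U\<^sup>2 * (1 + T) powr (1 + e) * V powr e"
      using U0 T0 V0 e pe by (simp add: powr_mult powr_powr)
    finally have "sum n X powr (1 + e) * V powr (- e) \<le> U\<^sup>2 * (1 + T) powr (1 + e) * V powr e * V powr (- e)"
      by (rule mult_right_mono) simp
    also have "\<dots> = U\<^sup>2 * (1 + T) powr (1 + e)" using V0 by (simp add: powr_minus)
    also have "\<dots> \<le> U\<^sup>2 * (1 + Q' + S' / 2)"
    proof (rule mult_left_mono)
      have "(1 + T) powr e * 1 powr (1 - e) \<le> e * (1 + T) + (1 - e) * 1"
        using e T0 by (intro Youngs_inequality_0) auto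
      then have "(1 + T) * (1 + T) powr e \<le> (1 + T) * (1 + e * T)"
        using T0 by (intro mult_left_mono) (auto simp: algebra_simps)
      also have "\<dots> \<le> 1 + (1 + 2 * e) * T"
        using mult_left_mono[OF T1, of "e * T"] e T0 by (simp add: algebra_simps)
      also have "\<dots> \<le> 1 + (1 + 2 * e) * ((p - 1) * Q' + (2 - p) * S')"
        using T_le e by (intro add_left_mono mult_left_mono) auto
      also have "\<dots> = 1 + ((1 + 2 * e) * (p - 1)) * Q' + ((1 + 2 * e) * (2 - p)) * S'"
        by (simp add: algebra_simps)
      also have "\<dots> \<le> 1 + 1 * Q' + 1/2 * S'"
      proof (intro add_mono mult_right_mono order_refl)
        show "(1 + 2 * e) * (p - 1) \<le> 1"
          unfolding p1 using e by (simp add: divide_simps) (simp add: algebra_simps)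
        define r where "r = e * e"
        have "r \<le> 1/8 * e" unfolding r_def using e by (intro mult_right_mono) auto
        moreover have eq: "(1 + 2 * e) * (2 * e) = 2 * e + 4 * r" by (simp add: r_def algebra_simps)
        ultimately have "(1 + 2 * e) * (2 * e) \<le> 1/2 * (1 + e)" unfolding eq using e by auto
        then have "(1 + 2 * e) * (2 * e) / (1 + e) \<le> 1/2" using e by (subst pos_divide_le_eq) auto
        then show "(1 + 2 * e) * (2 - p) \<le> 1/2" unfolding p1 by simp
      qed (use Q'0 QS in auto)
      finally show "(1 + T) powr (1 + e) \<le> 1 + Q' + S' / 2"
        using T0 by (simp add: powr_add)
    qed simp
    also have "\<dots> = U * S / 2 + Q - U\<^sup>2 / 2"
      unfolding SS QQ by (simp add: power2_eq_square field_simps)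
    finally show ?thesis by (simp add: Q_def S_def U_def)
  qed
qed

text \<open>Adding the pair \<open>(x0, y0)\<close> to a chain that avoids \<open>x0\<close> yields exactly the summand \<open>f x0\<close> by which the
  required total grows, because \<open>f x0\<close> is the smaller of the two values.\<close>

lemma chain_step:
  fixes f g :: "nat \<Rightarrow> real"
  assumes fin: "finite X" "finite Y" and x0: "x0 \<in> X" and y0: "y0 \<in> Y"
    and sep: "\<And>x y. x \<in> X - {x0} \<Longrightarrow> y \<in> Y \<Longrightarrow> x + y \<noteq> x0 + y0"
    and le: "f x0 \<le> g y0"
    and P: "P \<subseteq> (X - {x0}) \<times> Y" "inj_on (\<lambda>(x, y). x + y) P"
      "(\<Sum>(x, y)\<in>P. min (f x) (g y)) \<ge> sum f (X - {x0}) + sum g Y - M"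
  shows "\<exists>P\<subseteq>X \<times> Y. inj_on (\<lambda>(x, y). x + y) P \<and> (\<Sum>(x, y)\<in>P. min (f x) (g y)) \<ge> sum f X + sum g Y - M"
proof (intro exI[of _ "insert (x0, y0) P"] conjI)
  have "finite P" using P(1) fin by (meson finite_SigmaI finite_Diff finite_subset)
  moreover have "(x0, y0) \<notin> P" using P(1) by auto
  ultimately have "(\<Sum>(x, y)\<in>insert (x0, y0) P. min (f x) (g y)) = f x0 + (\<Sum>(x, y)\<in>P. min (f x) (g y))"
    using le by simp
  then show "(\<Sum>(x, y)\<in>insert (x0, y0) P. min (f x) (g y)) \<ge> sum f X + sum g Y - M"
    using P(3) sum.remove[OF fin(1) x0, of f] by simp
  have "x + y \<noteq> x0 + y0" if "(x, y) \<in> P" for x y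
    using sep P(1) that by blast
  then show "inj_on (\<lambda>(x, y). x + y) (insert (x0, y0) P)"
    using P(2) by (force simp: inj_on_insert)
qed (use P x0 y0 in auto)

lemma chain_swap:
  fixes f g :: "nat \<Rightarrow> real"
  assumes "\<exists>P\<subseteq>Y \<times> X. inj_on (\<lambda>(x, y). x + y) P \<and> (\<Sum>(x, y)\<in>P. min (g x) (f y)) \<ge> sum g Y + sum f X - M"
  shows "\<exists>P\<subseteq>X \<times> Y. inj_on (\<lambda>(x, y). x + y) P \<and> (\<Sum>(x, y)\<in>P. min (f x) (g y)) \<ge> sum f X + sum g Y - M"
proof -
  obtain P where P: "P \<subseteq> Y \<times> X" "inj_on (\<lambda>(x, y). x + y) P" "(\<Sum>(x, y)\<in>P. min (g x) (f y)) \<ge> sum g Y + sum f X - M"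
    using assms by blast
  have "(\<Sum>(x, y)\<in>prod.swap ` P. min (f x) (g y)) = (\<Sum>(x, y)\<in>P. min (g x) (f y))"
    by (subst sum.reindex) (auto simp: case_prod_beta min.commute intro!: sum.cong)
  moreover have "inj_on (\<lambda>(x, y). x + y) (prod.swap ` P)"
    using P(2) by (force simp: inj_on_def add.commute)
  ultimately show ?thesis using P by (intro exI[of _ "prod.swap ` P"]) auto
qed

text \<open>A weighted form of \<open>|X + Y| \<ge> |X| + |Y| - 1\<close>, which is the case of \<open>f\<close> and \<open>g\<close> constant. Among the
  four values of \<open>f\<close> and \<open>g\<close> at the least and greatest elements of \<open>X\<close> and \<open>Y\<close>, remove the element that
  carries the smallest, paired with the extreme element on the same side of the other set: their sum is
  less (or greater) than all sums that remain. The maximum \<open>M\<close> stays attained, since the opposite end of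
  the same set has at least the removed value.\<close>

lemma chain_exists:
  fixes f g :: "nat \<Rightarrow> real"
  assumes "finite X" "finite Y" "\<And>x. x \<in> X \<Longrightarrow> f x \<le> M" "\<And>y. y \<in> Y \<Longrightarrow> g y \<le> M" "M \<in> f ` X" "M \<in> g ` Y"
  shows "\<exists>P\<subseteq>X \<times> Y. inj_on (\<lambda>(x, y). x + y) P \<and> (\<Sum>(x, y)\<in>P. min (f x) (g y)) \<ge> sum f X + sum g Y - M"
  using assms
proof (induction "card X + card Y" arbitrary: X Y f g rule: less_induct)
  case less
  have single: "\<exists>P\<subseteq>X \<times> Y. inj_on (\<lambda>(x, y). x + y) P \<and> (\<Sum>(x, y)\<in>P. min (f x) (g y)) \<ge> sum f X + sum g Y - M"
    if "X = {x}" "f x = M" "\<And>y. y \<in> Y \<Longrightarrow> g y \<le> M" for X Y x and f g :: "nat \<Rightarrow> real"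
  proof (intro exI[of _ "{x} \<times> Y"] conjI)
    have "(\<Sum>(x, y)\<in>{x} \<times> Y. min (f x) (g y)) = (\<Sum>y\<in>Y. min (f x) (g y))"
      by (subst sum.cartesian_product[symmetric]) simp
    also have "\<dots> = sum g Y" using that by (intro sum.cong) (auto simp: min_def intro: antisym)
    finally show "(\<Sum>(x, y)\<in>{x} \<times> Y. min (f x) (g y)) \<ge> sum f X + sum g Y - M"
      using that by simp
  qed (use that in \<open>auto simp: inj_on_def\<close>)
  have step: "\<exists>P\<subseteq>X \<times> Y. inj_on (\<lambda>(x, y). x + y) P \<and> (\<Sum>(x, y)\<in>P. min (f x) (g y)) \<ge> sum f X + sum g Y - M"
    if fin: "finite X" "finite Y" and M: "\<And>x. x \<in> X \<Longrightarrow> f x \<le> M" "\<And>y. y \<in> Y \<Longrightarrow> g y \<le> M" "M \<in> f ` X" "M \<in> g ` Y"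
      and small: "\<And>(X' :: nat set) (Y' :: nat set) f g. card X' + card Y' < card X + card Y \<Longrightarrow> finite X' \<Longrightarrow> finite Y' \<Longrightarrow>
        (\<And>x. x \<in> X' \<Longrightarrow> f x \<le> M) \<Longrightarrow> (\<And>y. y \<in> Y' \<Longrightarrow> g y \<le> M) \<Longrightarrow> M \<in> f ` X' \<Longrightarrow> M \<in> g ` Y' \<Longrightarrow>
        \<exists>P\<subseteq>X' \<times> Y'. inj_on (\<lambda>(x, y). x + y) P \<and> (\<Sum>(x, y)\<in>P. min (f x) (g y)) \<ge> sum f X' + sum g Y' - M"
      and x0: "x0 \<in> X" and y0: "y0 \<in> Y"
      and sep: "\<And>x y. x \<in> X - {x0} \<Longrightarrow> y \<in> Y \<Longrightarrow> x + y \<noteq> x0 + y0"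
      and le: "f x0 \<le> g y0" and x1: "x1 \<in> X - {x0}" "f x0 \<le> f x1"
    for X Y x0 y0 x1 and f g :: "nat \<Rightarrow> real"
  proof -
    have "\<exists>P\<subseteq>(X - {x0}) \<times> Y. inj_on (\<lambda>(x, y). x + y) P \<and> (\<Sum>(x, y)\<in>P. min (f x) (g y)) \<ge> sum f (X - {x0}) + sum g Y - M"
    proof (rule small)
      show "card (X - {x0}) + card Y < card X + card Y"
        using card_Diff1_less[OF fin(1) x0] by simp
      obtain x where x: "x \<in> X" "f x = M" using M(3) by auto
      show "M \<in> f ` (X - {x0})"
      \<comment> \<open>if the removed element carries the maximum, then so does \<open>x1\<close>\<close>
      proof (cases "x = x0")
        case True
        then have "f x1 = M" using x x1 M(1)[of x1] by auto
        then show ?thesis using x1 by auto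
      qed (use x in auto)
    qed (use fin M in auto)
    then obtain P where "P \<subseteq> (X - {x0}) \<times> Y" "inj_on (\<lambda>(x, y). x + y) P"
      "(\<Sum>(x, y)\<in>P. min (f x) (g y)) \<ge> sum f (X - {x0}) + sum g Y - M" by blast
    then show ?thesis using sep le by (intro chain_step[OF fin x0 y0, of f g P M]) auto
  qed
  have ne: "X \<noteq> {}" "Y \<noteq> {}" using less.prems by auto
  define a b c d where abcd: "a = Min X" "b = Max X" "c = Min Y" "d = Max Y"
  have ext: "a \<in> X" "b \<in> X" "c \<in> Y" "d \<in> Y"
      "\<And>x. x \<in> X \<Longrightarrow> a \<le> x" "\<And>x. x \<in> X \<Longrightarrow> x \<le> b" "\<And>y. y \<in> Y \<Longrightarrow> c \<le> y" "\<And>y. y \<in> Y \<Longrightarrow> y \<le> d"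
    unfolding abcd using ne less.prems by auto
  have small': "card X' + card Y' < card Y + card X \<Longrightarrow> finite X' \<Longrightarrow> finite Y' \<Longrightarrow>
        (\<And>x. x \<in> X' \<Longrightarrow> f x \<le> M) \<Longrightarrow> (\<And>y. y \<in> Y' \<Longrightarrow> g y \<le> M) \<Longrightarrow> M \<in> f ` X' \<Longrightarrow> M \<in> g ` Y' \<Longrightarrow>
        \<exists>P\<subseteq>X' \<times> Y'. inj_on (\<lambda>(x, y). x + y) P \<and> (\<Sum>(x, y)\<in>P. min (f x) (g y)) \<ge> sum f X' + sum g Y' - M"
    for X' Y' and f g :: "nat \<Rightarrow> real"
    using less.hyps[of X' Y'] by (simp add: add.commute)
  consider (X) "a = b" | (Y) "c = d" | (ab) "a < b" "c < d"
    using ext(1,3,5,6,7,8) by (meson le_neq_implies_less)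
  then show ?case
  proof cases
    case X
    have "X = {a}"
    proof -
      have "x = a" if "x \<in> X" for x using ext(5)[OF that] ext(6)[OF that] X by simp
      then show ?thesis using ext(1,3) by blast
    qed
    then show ?thesis using less.prems by (intro single) auto
  next
    case Y
    have "Y = {c}"
    proof -
      have "y = c" if "y \<in> Y" for y using ext(7)[OF that] ext(8)[OF that] Y by simp
      then show ?thesis using ext(1,3) by blast
    qed
    then have "g c = M" using less.prems(6) by auto
    show ?thesis by (rule chain_swap, rule single[of Y c g X f]) (use \<open>Y = {c}\<close> \<open>g c = M\<close> less.prems(3) in auto)
  next
    case ab
    have sa: "x + y \<noteq> a + c" if "x \<in> X - {a}" "y \<in> Y" for x y using ext(5)[of x] ext(7)[of y] that by auto
    have sb: "x + y \<noteq> b + d" if "x \<in> X - {b}" "y \<in> Y" for x y using ext(6)[of x] ext(8)[of y] that by fastforce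
    have sc: "y + x \<noteq> c + a" if "y \<in> Y - {c}" "x \<in> X" for x y using ext(5)[of x] ext(7)[of y] that by auto
    have sd: "y + x \<noteq> d + b" if "y \<in> Y - {d}" "x \<in> X" for x y using ext(6)[of x] ext(8)[of y] that by fastforce
    consider (fa) "f a \<le> f b" "f a \<le> g c" | (fb) "f b \<le> f a" "f b \<le> g d"
      | (gc) "g c \<le> g d" "g c \<le> f a" | (gd) "g d \<le> g c" "g d \<le> f b"
      by linarith
    then show ?thesis
    proof cases
      case fa
      show ?thesis
        by (rule step[OF less.prems less.hyps, of a c b]) (use fa ext ab sa in auto)
    next
      case fb
      show ?thesis
        by (rule step[OF less.prems less.hyps, of b d a]) (use fb ext ab sb in auto)
    next
      case gc
      show ?thesis
        by (rule chain_swap, rule step[OF less.prems(2,1,4,3,6,5) small', of c a d]) (use gc ext ab sc in auto)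
    next
      case gd
      show ?thesis
        by (rule chain_swap, rule step[OF less.prems(2,1,4,3,6,5) small', of d b c]) (use gd ext ab sd in auto)
    qed
  qed
qed

section \<open>Growth of product sets\<close>

definition fiber :: "nat \<Rightarrow> nat set \<Rightarrow> nat \<Rightarrow> nat set" where
  "fiber p A j = {a \<in> A. multiplicity p a = j}"

definition separates :: "nat list \<Rightarrow> nat set \<Rightarrow> bool" where
  "separates ps A \<longleftrightarrow> (\<forall>a\<in>A. \<forall>b\<in>A. (\<forall>p\<in>set ps. multiplicity p a = multiplicity p b) \<longrightarrow> a = b)"

text \<open>The best total weight of a subset of \<open>A\<close>, when an element that is isolated after \<open>d\<close> queries weighs
  \<open>D\<^sup>-\<^sup>d\<close>. At each prime there are two options: to restrict to one fibre, which costs nothing but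
  discards the other fibres, or to query, which retains all of them.\<close>

fun query_weight :: "real \<Rightarrow> nat list \<Rightarrow> nat set \<Rightarrow> real" where
  "query_weight D [] A = 1"
| "query_weight D (p # ps) A =
     max (Max ((\<lambda>j. query_weight D ps (fiber p A j)) ` multiplicity p ` A))
         ((\<Sum>j\<in>multiplicity p ` A. query_weight D ps (fiber p A j)) / D)"

lemma separates_fiber: "separates (p # ps) A \<Longrightarrow> separates ps (fiber p A j)"
  unfolding separates_def fiber_def by auto

lemma fiber_subset: "fiber p A j \<subseteq> A"
  unfolding fiber_def by auto

lemma fiber_nonempty: "j \<in> multiplicity p ` A \<Longrightarrow> fiber p A j \<noteq> {}"
  unfolding fiber_def by auto

lemma separates_Nil:
  assumes "separates [] A" "A \<noteq> {}"
  obtains a where "A = {a}"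
  using assms unfolding separates_def by auto

lemma query_weight_pos:
  assumes "finite A" "A \<noteq> {}"
  shows "query_weight D ps A > 0"
  using assms
proof (induction ps arbitrary: A)
  case (Cons p ps)
  then obtain a where a: "a \<in> A" by auto
  let ?j = "multiplicity p a"
  have "0 < query_weight D ps (fiber p A ?j)"
    using a Cons.prems by (intro Cons.IH fiber_nonempty finite_subset[OF fiber_subset]) auto
  also have "\<dots> \<le> Max ((\<lambda>j. query_weight D ps (fiber p A j)) ` multiplicity p ` A)"
    using a Cons.prems by (intro Max_ge) auto
  finally show ?case by simp
qed simp

text \<open>The recursion for \<open>query_weight\<close> describes the construction of an actual weight function: a single
  fibre contributes its own weight function, and a query glues the weight functions of all fibres
  together.\<close>

lemma query_weight_attained:
  assumes query: "\<And>p w. prime p \<Longrightarrow> (\<And>j. dominating (Suc m) (w j)) \<Longrightarrow>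
      dominating (Suc m) (\<lambda>n. w (multiplicity p n) n / D)" and D: "D > 0"
    and "finite A" "A \<noteq> {}" "0 \<notin> A" "separates ps A" "\<And>p. p \<in> set ps \<Longrightarrow> prime p"
  shows "\<exists>w. dominating (Suc m) w \<and> (\<forall>b. w b \<ge> 0) \<and> (\<forall>b. b \<notin> A \<longrightarrow> w b = 0) \<and> sum w A = query_weight D ps A"
  using assms(3-)
proof (induction ps arbitrary: A)
  case Nil
  then obtain a where a: "A = {a}" using separates_Nil by blast
  then show ?case using Nil
    by (intro exI[of _ "indicator {a}"] conjI dominating_indicator) auto
next
  case (Cons p ps)
  define J where "J = multiplicity p ` A"
  have J: "finite J" "J \<noteq> {}" using Cons.prems by (auto simp: J_def)
  have "\<exists>w. dominating (Suc m) w \<and> (\<forall>b. w b \<ge> 0) \<and> (\<forall>b. b \<notin> fiber p A j \<longrightarrow> w b = 0)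
      \<and> (j \<in> J \<longrightarrow> sum w (fiber p A j) = query_weight D ps (fiber p A j))" for j
  proof (cases "j \<in> J")
    case True
    then have "\<exists>w. dominating (Suc m) w \<and> (\<forall>b. w b \<ge> 0) \<and> (\<forall>b. b \<notin> fiber p A j \<longrightarrow> w b = 0)
      \<and> sum w (fiber p A j) = query_weight D ps (fiber p A j)"
      using Cons.prems unfolding J_def
      by (intro Cons.IH finite_subset[OF fiber_subset] fiber_nonempty separates_fiber[of p])
         (auto simp: fiber_def)
    then show ?thesis by blast
  next
    case False
    then show ?thesis by (intro exI[of _ "\<lambda>_. 0"]) (auto simp: dominating_zero)
  qed
  then obtain w where w: "\<And>j. dominating (Suc m) (w j)" "\<And>j b. w j b \<ge> 0" "\<And>j b. b \<notin> fiber p A j \<Longrightarrow> w j b = 0"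
    "\<And>j. j \<in> J \<Longrightarrow> sum (w j) (fiber p A j) = query_weight D ps (fiber p A j)"
    by metis
  let ?f = "\<lambda>j. query_weight D ps (fiber p A j)"
  show ?case
  proof (cases "Max (?f ` J) \<ge> (\<Sum>j\<in>J. ?f j) / D")
    case True
    have "Max (?f ` J) \<in> ?f ` J" using J by (intro Max_in) auto
    then obtain j where j: "j \<in> J" "Max (?f ` J) = ?f j" by blast
    have "sum (w j) A = sum (w j) (fiber p A j)"
      using Cons.prems w(3)[of _ j] fiber_subset by (intro sum.mono_neutral_right) auto
    then have "sum (w j) A = query_weight D (p # ps) A"
      using j True w(4) by (simp add: J_def[symmetric] max_def)
    then show ?thesis using w fiber_subset by (intro exI[of _ "w j"]) blast
  next
    case False
    let ?w = "\<lambda>n. w (multiplicity p n) n / D"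
    have "sum ?w A = (\<Sum>j\<in>J. \<Sum>n\<in>{n\<in>A. multiplicity p n = j}. ?w n)"
      unfolding J_def using Cons.prems by (intro sum.group[symmetric]) auto
    also have "\<dots> = (\<Sum>j\<in>J. sum (w j) (fiber p A j) / D)"
      unfolding sum_divide_distrib fiber_def by (intro sum.cong) auto
    also have "\<dots> = query_weight D (p # ps) A"
      using False w(4) by (simp add: J_def[symmetric] max_def sum_divide_distrib)
    finally have "sum ?w A = query_weight D (p # ps) A" .
    moreover have "dominating (Suc m) ?w"
      using Cons.prems w by (intro query) auto
    moreover have "?w b = 0" if "b \<notin> A" for b
      using w(3)[of b] that by (simp add: fiber_def)
    ultimately show ?thesis using w(2) D by (intro exI[of _ ?w]) auto
  qed
qed

text \<open>Products from the fibres over \<open>x\<close> and \<open>y\<close> have valuation \<open>x + y\<close>, so pairs with different sums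
  give disjoint parts of the product set.\<close>

lemma card_times_fibers_le:
  assumes p: "prime p" and A: "finite A" "0 \<notin> A" and B: "finite B" "0 \<notin> B"
    and P: "finite P" "inj_on (\<lambda>(x, y). x + y) P"
  shows "(\<Sum>(x, y)\<in>P. real (card (fiber p A x * fiber p B y))) \<le> real (card (A * B))"
proof -
  let ?F = "\<lambda>z. fiber p A (fst z) * fiber p B (snd z)"
  have mult: "multiplicity p n = fst z + snd z" if nz: "n \<in> ?F z" for n z
  proof -
    obtain a b where ab: "n = a * b" "a \<in> fiber p A (fst z)" "b \<in> fiber p B (snd z)"
      using nz by (rule set_times_elim)
    then have "a \<noteq> 0" "b \<noteq> 0" using A B by (auto simp: fiber_def intro!: Nat.gr0I)
    then show ?thesis using ab p by (simp add: prime_elem_multiplicity_mult_distrib fiber_def)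
  qed
  have fin: "finite (?F z)" for z
    using A B by (intro finite_set_times finite_subset[OF fiber_subset])
  have "(\<Sum>z\<in>P. card (?F z)) = card (\<Union>z\<in>P. ?F z)"
  proof (rule card_UN_disjoint[symmetric])
    show "\<forall>z\<in>P. \<forall>z'\<in>P. z \<noteq> z' \<longrightarrow> ?F z \<inter> ?F z' = {}"
    proof (intro ballI impI, rule ccontr)
      fix z z' assume z: "z \<in> P" "z' \<in> P" "z \<noteq> z'" "?F z \<inter> ?F z' \<noteq> {}"
      then obtain n where "n \<in> ?F z" "n \<in> ?F z'" by blast
      then have "fst z + snd z = fst z' + snd z'" using mult by metis
      then show False using inj_onD[OF P(2) _ z(1,2)] z(3) by (simp add: case_prod_beta)
    qed
  qed (use P fin in auto)
  also have "\<dots> \<le> card (A * B)"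
    using A B fiber_subset by (intro card_mono finite_set_times UN_least set_times_mono2) auto
  finally have "real (\<Sum>z\<in>P. card (?F z)) \<le> real (card (A * B))" by (rule of_nat_mono)
  then show ?thesis by (simp only: case_prod_beta' of_nat_sum)
qed

lemma sum_card_fiber:
  assumes "finite A"
  shows "(\<Sum>j\<in>multiplicity p ` A. real (card (fiber p A j))) = real (card A)"
  using assms sum.group[of A "multiplicity p ` A" "multiplicity p" "\<lambda>_. 1 :: real"]
  by (simp add: fiber_def)

lemma arg_max_exists:
  fixes u :: "'i \<Rightarrow> real"
  assumes "finite X" "X \<noteq> {}"
  obtains x0 where "x0 \<in> X" "\<And>x. x \<in> X \<Longrightarrow> u x \<le> u x0"
proof -
  have "Max (u ` X) \<in> u ` X" using assms by (intro Max_in) auto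
  then obtain x0 where "x0 \<in> X" "Max (u ` X) = u x0" by auto
  then show ?thesis using assms by (intro that[of x0]) (auto intro: Max_ge simp flip: \<open>Max (u ` X) = u x0\<close>)
qed

text \<open>The exponents are chosen such that a lower bound for \<open>|AA|\<^sup>2\<close> by the square of this quantity says that
  the density \<open>W/|A|\<close> is at least a power of \<open>|A|/|AA|\<close>.\<close>

definition growth_potential :: "real \<Rightarrow> real \<Rightarrow> nat list \<Rightarrow> nat set \<Rightarrow> real" where
  "growth_potential e D ps A = real (card A) powr (1 + e) * query_weight D ps A powr (- e)"

lemma growth_potential_pos:
  assumes "finite A" "A \<noteq> {}"
  shows "growth_potential e D ps A > 0"
  using assms query_weight_pos[of A D ps] by (auto simp: growth_potential_def card_gt_0_iff)

lemma growth_potential_Cons_le: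
  assumes A: "finite A" "A \<noteq> {}" and e: "0 < e" "e \<le> 1/8" and D: "D > 0" "D powr e \<le> 5/4"
    and u: "\<And>x. u x = sqrt (growth_potential e D ps (fiber p A x))"
    and x0: "x0 \<in> multiplicity p ` A" "\<And>x. x \<in> multiplicity p ` A \<Longrightarrow> u x \<le> u x0"
  shows "growth_potential e D (p # ps) A \<le>
    u x0 * sum u (multiplicity p ` A) / 2 + (\<Sum>x\<in>multiplicity p ` A. (u x)\<^sup>2) - (u x0)\<^sup>2 / 2"
proof -
  let ?X = "multiplicity p ` A"
  have fib: "finite (fiber p A x)" "fiber p A x \<noteq> {}" if "x \<in> ?X" for x
    using A that finite_subset[OF fiber_subset] fiber_nonempty by auto
  have "sum (\<lambda>x. real (card (fiber p A x))) ?X powr (1 + e) * query_weight D (p # ps) A powr (- e) \<le>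
    u x0 * sum u ?X / 2 + (\<Sum>x\<in>?X. (u x)\<^sup>2) - (u x0)\<^sup>2 / 2"
  proof (rule gain_inequality[where D = D and W = "\<lambda>x. query_weight D ps (fiber p A x)"])
    show "real (card (fiber p A x)) > 0" "query_weight D ps (fiber p A x) > 0" "u x > 0"
      "(u x)\<^sup>2 = real (card (fiber p A x)) powr (1 + e) * query_weight D ps (fiber p A x) powr (- e)"
      if "x \<in> ?X" for x
      using fib[OF that] growth_potential_pos[OF fib[OF that], of e D ps] query_weight_pos[OF fib[OF that]]
      by (auto simp: card_gt_0_iff u) (simp add: growth_potential_def)
    show "query_weight D ps (fiber p A x) \<le> query_weight D (p # ps) A" if "x \<in> ?X" for x
      using A that by (auto intro!: max.coboundedI1 Max_ge)
  qed (use A e D x0 in auto)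
  then show ?thesis using A by (simp only: sum_card_fiber growth_potential_def)
qed

text \<open>Three families of pairs are used, each with distinct sums: \<open>X\<close> against the maximal \<open>y0\<close>, \<open>Y\<close> against
  the maximal \<open>x0\<close>, and the chain provided by \<open>chain_exists\<close> for the squares of \<open>u/U\<close> and \<open>v/V\<close>. The
  mean of the resulting bounds is \<open>U V (G + H)/2\<close> with \<open>G\<close> depending on \<open>u\<close> only and \<open>H\<close> on \<open>v\<close> only, and
  \<open>(G + H)/2\<close> is at least the geometric mean. Thus the bound becomes a product of one factor for each
  set, which is what makes the induction over the primes possible.\<close>

lemma sumset_growth_step:
  fixes u v :: "nat \<Rightarrow> real"
  assumes XY: "finite X" "finite Y" and x0: "x0 \<in> X" "\<And>x. x \<in> X \<Longrightarrow> u x \<le> u x0"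
    and y0: "y0 \<in> Y" "\<And>y. y \<in> Y \<Longrightarrow> v y \<le> v y0"
    and pos: "\<And>x. x \<in> X \<Longrightarrow> u x > 0" "\<And>y. y \<in> Y \<Longrightarrow> v y > 0"
    and S: "\<And>P. P \<subseteq> X \<times> Y \<Longrightarrow> inj_on (\<lambda>(x, y). x + y) P \<Longrightarrow> (\<Sum>(x, y)\<in>P. u x * v y) \<le> S"
  shows "(u x0 * sum u X / 2 + (\<Sum>x\<in>X. (u x)\<^sup>2) - (u x0)\<^sup>2 / 2) *
         (v y0 * sum v Y / 2 + (\<Sum>y\<in>Y. (v y)\<^sup>2) - (v y0)\<^sup>2 / 2) \<le> S\<^sup>2"
proof -
  define U V where "U = u x0" and "V = v y0"
  have UV: "U > 0" "V > 0" using pos x0 y0 by (auto simp: U_def V_def)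
  define a b where "a = sum u X / U" and "b = sum v Y / V"
  define f g where "f = (\<lambda>x. (u x / U)\<^sup>2)" and "g = (\<lambda>y. (v y / V)\<^sup>2)"
  have S1: "V * sum u X \<le> S"
  proof -
    have "(\<Sum>(x, y)\<in>X \<times> {y0}. u x * v y) \<le> S"
      using y0 by (intro S) (auto simp: inj_on_def)
    then show ?thesis
      by (subst (asm) sum.cartesian_product[symmetric]) (simp add: V_def sum_distrib_left mult.commute)
  qed
  have S2: "U * sum v Y \<le> S"
  proof -
    have "(\<Sum>(x, y)\<in>{x0} \<times> Y. u x * v y) \<le> S"
      using x0 by (intro S) (auto simp: inj_on_def)
    then show ?thesis
      by (subst (asm) sum.cartesian_product[symmetric]) (simp add: U_def sum_distrib_left)
  qed
  have "\<exists>P\<subseteq>X \<times> Y. inj_on (\<lambda>(x, y). x + y) P \<and> (\<Sum>(x, y)\<in>P. min (f x) (g y)) \<ge> sum f X + sum g Y - 1"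
  proof (rule chain_exists[OF XY])
    show "f x \<le> 1" if "x \<in> X" for x
      using that x0 pos[of x] UV by (simp add: f_def U_def power_le_one less_imp_le)
    show "g y \<le> 1" if "y \<in> Y" for y
      using that y0 pos[of y] UV by (simp add: g_def V_def power_le_one less_imp_le)
    show "1 \<in> f ` X" "1 \<in> g ` Y"
      using x0 y0 UV by (force simp: f_def U_def, force simp: g_def V_def)
  qed
  then obtain P where P: "P \<subseteq> X \<times> Y" "inj_on (\<lambda>(x, y). x + y) P"
    "(\<Sum>(x, y)\<in>P. min (f x) (g y)) \<ge> sum f X + sum g Y - 1" by blast
  have S3: "U * V * (sum f X + sum g Y - 1) \<le> S"
  proof -
    have "U * V * (sum f X + sum g Y - 1) \<le> U * V * (\<Sum>(x, y)\<in>P. min (f x) (g y))"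
      using UV P(3) by (intro mult_left_mono) auto
    also have "\<dots> = (\<Sum>(x, y)\<in>P. U * V * min (f x) (g y))"
      by (simp add: sum_distrib_left case_prod_beta)
    also have "\<dots> \<le> (\<Sum>(x, y)\<in>P. u x * v y)"
    proof (rule sum_mono, clarify)
      fix x y assume "(x, y) \<in> P"
      then have xy: "u x > 0" "v y > 0" using P(1) pos by auto
      define s t where "s = u x / U" and "t = v y / V"
      have st: "s > 0" "t > 0" using xy UV by (auto simp: s_def t_def)
      have "min (s\<^sup>2) (t\<^sup>2) \<le> s * t"
      proof (cases "s \<le> t")
        case True
        then have "s * s \<le> s * t" using st by (intro mult_left_mono) auto
        then show ?thesis by (simp add: power2_eq_square min.coboundedI1)
      next
        case False
        then have "t * t \<le> s * t" using st by (intro mult_right_mono) auto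
        then show ?thesis by (simp add: power2_eq_square min.coboundedI2)
      qed
      then have "U * V * min (f x) (g y) \<le> U * V * (s * t)"
        unfolding f_def g_def s_def t_def using UV by (intro mult_left_mono) auto
      also have "\<dots> = u x * v y" using UV by (simp add: s_def t_def)
      finally show "U * V * min (f x) (g y) \<le> u x * v y" .
    qed
    also have "\<dots> \<le> S" by (rule S[OF P(1,2)])
    finally show ?thesis .
  qed
  define G H where "G = a / 2 + sum f X - 1/2" and "H = b / 2 + sum g Y - 1/2"
  have f1: "sum f X \<ge> 1"
  proof -
    have "f x0 \<le> sum f X" using XY x0 by (intro member_le_sum) (auto simp: f_def)
    then show ?thesis using UV by (simp add: f_def U_def)
  qed
  have g1: "sum g Y \<ge> 1"
  proof -
    have "g y0 \<le> sum g Y" using XY y0 by (intro member_le_sum) (auto simp: g_def)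
    then show ?thesis using UV by (simp add: g_def V_def)
  qed
  have "sum u X \<ge> 0" "sum v Y \<ge> 0" using pos by (auto intro!: sum_nonneg simp: less_imp_le)
  then have "a \<ge> 0" "b \<ge> 0" unfolding a_def b_def using UV by auto
  then have GH: "G \<ge> 0" "H \<ge> 0" using f1 g1 by (auto simp: G_def H_def)
  have VU: "V * sum u X = U * V * a" "U * sum v Y = U * V * b" using UV by (auto simp: a_def b_def)
  have "U * V * (G + H) = (V * sum u X + U * sum v Y) / 2 + U * V * (sum f X + sum g Y - 1)"
    unfolding G_def H_def VU by (simp add: field_simps)
  also have "\<dots> \<le> (S + S) / 2 + S"
    by (intro add_mono divide_right_mono S1 S2 S3) simp
  finally have "U * V * (G + H) \<le> 2 * S" by simp
  then have "(U * V * (G + H))\<^sup>2 \<le> (2 * S)\<^sup>2"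
    using UV GH by (intro power_mono) auto
  moreover have "4 * (U\<^sup>2 * G * (V\<^sup>2 * H)) \<le> (U * V * (G + H))\<^sup>2"
  proof -
    have "0 \<le> (U * V)\<^sup>2 * (G - H)\<^sup>2" by simp
    then show ?thesis by (simp add: power2_eq_square algebra_simps)
  qed
  ultimately have "U\<^sup>2 * G * (V\<^sup>2 * H) \<le> S\<^sup>2" by (simp add: power_mult_distrib)
  moreover have "U\<^sup>2 * G = u x0 * sum u X / 2 + (\<Sum>x\<in>X. (u x)\<^sup>2) - (u x0)\<^sup>2 / 2"
  proof -
    have "U\<^sup>2 * sum f X = (\<Sum>x\<in>X. (u x)\<^sup>2)"
      using UV by (simp add: f_def sum_distrib_left power_divide)
    moreover have "U\<^sup>2 * a = U * sum u X" using UV by (simp add: a_def power2_eq_square)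
    ultimately show ?thesis by (simp add: G_def U_def[symmetric] algebra_simps)
  qed
  moreover have "V\<^sup>2 * H = v y0 * sum v Y / 2 + (\<Sum>y\<in>Y. (v y)\<^sup>2) - (v y0)\<^sup>2 / 2"
  proof -
    have "V\<^sup>2 * sum g Y = (\<Sum>y\<in>Y. (v y)\<^sup>2)"
      using UV by (simp add: g_def sum_distrib_left power_divide)
    moreover have "V\<^sup>2 * b = V * sum v Y" using UV by (simp add: b_def power2_eq_square)
    ultimately show ?thesis by (simp add: H_def V_def[symmetric] algebra_simps)
  qed
  ultimately show ?thesis by simp
qed

text \<open>Induction over the primes. The hypothesis bounds the product of two fibres from below by a product
  \<open>u x * v y\<close>, \<open>sumset_growth_step\<close> collects these bounds over pairs of fibres, and
  \<open>growth_potential_Cons_le\<close> recognises the potential of the whole set in each of the two factors.\<close>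

lemma product_set_growth:
  assumes e: "0 < e" "e \<le> 1/8" and D: "D > 0" "D powr e \<le> 5/4"
    and "finite A" "A \<noteq> {}" "0 \<notin> A" "separates ps A"
    and "finite B" "B \<noteq> {}" "0 \<notin> B" "separates ps B" "\<And>p. p \<in> set ps \<Longrightarrow> prime p"
  shows "growth_potential e D ps A * growth_potential e D ps B \<le> (real (card (A * B)))\<^sup>2"
  using assms(5-)
proof (induction ps arbitrary: A B)
  case Nil
  then obtain a b where "A = {a}" "B = {b}" using separates_Nil by metis
  then show ?case by (simp add: growth_potential_def set_times_def)
next
  case (Cons p ps)
  define u v where "u = (\<lambda>x. sqrt (growth_potential e D ps (fiber p A x)))"
    and "v = (\<lambda>y. sqrt (growth_potential e D ps (fiber p B y)))"
  let ?X = "multiplicity p ` A" and ?Y = "multiplicity p ` B"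
  have XY: "finite ?X" "?X \<noteq> {}" "finite ?Y" "?Y \<noteq> {}" using Cons.prems by auto
  obtain x0 where x0: "x0 \<in> ?X" "\<And>x. x \<in> ?X \<Longrightarrow> u x \<le> u x0" using arg_max_exists XY by metis
  obtain y0 where y0: "y0 \<in> ?Y" "\<And>y. y \<in> ?Y \<Longrightarrow> v y \<le> v y0" using arg_max_exists XY by metis
  have fibA: "finite (fiber p A x)" "fiber p A x \<noteq> {}" if "x \<in> ?X" for x
    using Cons.prems that finite_subset[OF fiber_subset] fiber_nonempty by auto
  have fibB: "finite (fiber p B y)" "fiber p B y \<noteq> {}" if "y \<in> ?Y" for y
    using Cons.prems that finite_subset[OF fiber_subset] fiber_nonempty by auto
  have pos: "u x > 0" if "x \<in> ?X" for x
    unfolding u_def using growth_potential_pos[OF fibA[OF that]] by simp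
  have pos': "v y > 0" if "y \<in> ?Y" for y
    unfolding v_def using growth_potential_pos[OF fibB[OF that]] by simp
  have prod: "u x * v y \<le> real (card (fiber p A x * fiber p B y))" if "x \<in> ?X" "y \<in> ?Y" for x y
  proof -
    have "growth_potential e D ps (fiber p A x) * growth_potential e D ps (fiber p B y) \<le> (real (card (fiber p A x * fiber p B y)))\<^sup>2"
      using fibA[OF that(1)] fibB[OF that(2)] Cons.prems separates_fiber
      by (intro Cons.IH) (auto simp: fiber_def)
    then show ?thesis
      unfolding u_def v_def real_sqrt_mult[symmetric] by (rule real_le_lsqrt[rotated]) simp
  qed
  have "growth_potential e D (p # ps) A * growth_potential e D (p # ps) B \<le>
      (u x0 * sum u ?X / 2 + (\<Sum>x\<in>?X. (u x)\<^sup>2) - (u x0)\<^sup>2 / 2) *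
      (v y0 * sum v ?Y / 2 + (\<Sum>y\<in>?Y. (v y)\<^sup>2) - (v y0)\<^sup>2 / 2)"
  proof (rule mult_mono)
    show le: "growth_potential e D (p # ps) A \<le> u x0 * sum u ?X / 2 + (\<Sum>x\<in>?X. (u x)\<^sup>2) - (u x0)\<^sup>2 / 2"
      using Cons.prems e D x0 by (intro growth_potential_Cons_le) (auto simp: u_def)
    show "growth_potential e D (p # ps) B \<le> v y0 * sum v ?Y / 2 + (\<Sum>y\<in>?Y. (v y)\<^sup>2) - (v y0)\<^sup>2 / 2"
      using Cons.prems e D y0 by (intro growth_potential_Cons_le) (auto simp: v_def)
    show "0 \<le> u x0 * sum u ?X / 2 + (\<Sum>x\<in>?X. (u x)\<^sup>2) - (u x0)\<^sup>2 / 2"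
      using le growth_potential_pos[of A e D "p # ps"] Cons.prems by linarith
    show "0 \<le> growth_potential e D (p # ps) B"
      using growth_potential_pos[of B e D "p # ps"] Cons.prems by linarith
  qed
  also have "\<dots> \<le> (real (card (A * B)))\<^sup>2"
  proof (rule sumset_growth_step[where u = u and v = v, OF XY(1,3) x0 y0 pos pos'])
    fix P assume P: "P \<subseteq> ?X \<times> ?Y" "inj_on (\<lambda>(x, y). x + y) P"
    have "(\<Sum>(x, y)\<in>P. u x * v y) \<le> (\<Sum>(x, y)\<in>P. real (card (fiber p A x * fiber p B y)))"
      using P(1) prod by (intro sum_mono) auto
    also have "\<dots> \<le> real (card (A * B))"
      using P XY Cons.prems by (intro card_times_fibers_le) (auto intro: finite_subset)
    finally show "(\<Sum>(x, y)\<in>P. u x * v y) \<le> real (card (A * B))" .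
  qed
  finally show ?case .
qed

section \<open>From the doubling constant to the norm\<close>

text \<open>Norms on a probability space increase with the exponent. Concavity of \<open>x\<^sup>t\<close> with \<open>t = q/2k\<close> bounds it by
  its tangent at \<open>1\<close>, which is applied to \<open>(|F|/b)\<^sup>2\<^sup>k\<close>.\<close>

lemma circle_norm_le:
  assumes F: "continuous_on {0..1} F" and q: "q > 2" "q \<le> 2 * real k" and b: "b > 0"
    and mom: "moment k F \<le> b ^ (2 * k)"
  shows "circle_norm q F \<le> b"
proof -
  define t where "t = q / (2 * real k)"
  have t: "0 \<le> t" "t \<le> 1" using q by (auto simp: t_def)
  have cont: "continuous_on {0..1} (\<lambda>\<theta>. cmod (F \<theta>) powr q)"
    using q by (intro continuous_on_powr' continuous_intros F) auto
  have pt: "cmod (F \<theta>) powr q \<le> b powr q * (1 - t) + b powr q * t / b ^ (2 * k) * cmod (F \<theta>) ^ (2 * k)" for \<theta>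
  proof (cases "F \<theta> = 0")
    case True
    then show ?thesis using t b by simp
  next
    case False
    define x where "x = cmod (F \<theta>) / b"
    have x: "x > 0" using False b by (simp add: x_def)
    have "(x ^ (2 * k)) powr t * 1 powr (1 - t) \<le> t * x ^ (2 * k) + (1 - t) * 1"
      using x t by (intro Youngs_inequality_0) auto
    moreover have "(x ^ (2 * k)) powr t = x powr q"
      using x q by (simp add: powr_powr t_def flip: powr_realpow)
    ultimately have "b powr q * x powr q \<le> b powr q * (t * x ^ (2 * k) + (1 - t))"
      by (intro mult_left_mono) auto
    moreover have "b powr q * x powr q = cmod (F \<theta>) powr q"
      using b by (simp add: x_def powr_divide)
    ultimately show ?thesis by (simp add: x_def power_divide algebra_simps)
  qed
  have "integral {0..1} (\<lambda>\<theta>. cmod (F \<theta>) powr q)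
      \<le> integral {0..1} (\<lambda>\<theta>. b powr q * (1 - t) + b powr q * t / b ^ (2 * k) * cmod (F \<theta>) ^ (2 * k))"
    by (intro integral_le integrable_continuous_interval cont pt continuous_intros F)
  also have "\<dots> = b powr q * (1 - t) * 1 + b powr q * t / b ^ (2 * k) * moment k F"
    unfolding moment_def
    by (intro integral_unique has_integral_add has_integral_mult_right integrable_integral
        integrable_continuous_interval continuous_intros F) (use has_integral_const_real[of "b powr q * (1 - t)" 0 1] in simp)
  also have "\<dots> \<le> b powr q * (1 - t) * 1 + b powr q * t / b ^ (2 * k) * b ^ (2 * k)"
    using mom t b by (intro add_left_mono mult_left_mono) auto
  also have "\<dots> = b powr q" using b by (simp add: algebra_simps)
  finally have le: "integral {0..1} (\<lambda>\<theta>. cmod (F \<theta>) powr q) \<le> b powr q" .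
  have "circle_norm q F = integral {0..1} (\<lambda>\<theta>. cmod (F \<theta>) powr q) powr (1 / q)"
    unfolding circle_norm_def
    by (subst set_borel_integral_eq_integral(2)[OF borel_integrable_atLeastAtMost']) (auto intro: cont)
  also have "\<dots> \<le> (b powr q) powr (1 / q)"
    using le q by (intro powr_mono2) (auto intro!: integral_nonneg integrable_continuous_interval cont)
  also have "\<dots> = b" using b q by (simp add: powr_powr)
  finally show ?thesis .
qed

lemma card_le_card_times:
  fixes A :: "int set"
  assumes "finite A" "a \<in> A" "a \<noteq> 0"
  shows "card A \<le> card (A * A)"
proof -
  have "card A = card ((*) a ` A)" using assms by (intro card_image[symmetric]) (auto simp: inj_on_def)
  also have "\<dots> \<le> card (A * A)" using assms by (intro card_mono finite_set_times) (auto intro: set_times_intro)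
  finally show ?thesis .
qed

lemma exists_separating_primes:
  fixes B :: "nat set"
  assumes "finite B" "0 \<notin> B"
  obtains ps where "separates ps B" "\<And>p. p \<in> set ps \<Longrightarrow> prime p"
proof -
  have "finite (\<Union>b\<in>B. prime_factors b)" using assms by auto
  then obtain ps where ps: "set ps = (\<Union>b\<in>B. prime_factors b)" using finite_list by blast
  have "separates ps B"
    unfolding separates_def
  proof (intro ballI impI)
    fix a b assume ab: "a \<in> B" "b \<in> B" and eq: "\<forall>p\<in>set ps. multiplicity p a = multiplicity p b"
    have "multiplicity p a = multiplicity p b" if "prime p" for p
    proof (cases "p \<in> set ps")
      case False
      then have "\<not> p dvd a" "\<not> p dvd b"
        using ab that assms unfolding ps by (auto simp: in_prime_factors_iff)
      then show ?thesis by (simp add: not_dvd_imp_multiplicity_0)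
    qed (use eq in auto)
    moreover have "a > 0" "b > 0" using ab assms(2) by (metis neq0_conv)+
    ultimately show "a = b" by (rule multiplicity_eq_nat[rotated 2]) simp_all
  qed
  then show ?thesis using ps by (intro that[of ps]) auto
qed

text \<open>Valuations do not see signs and say nothing about zero. Passing to absolute values removes them at the cost of
  a constant factor in the size, and does not enlarge the product set.\<close>

lemma abs_image_properties:
  fixes A :: "int set"
  assumes A: "finite A" "card A \<ge> 2"
  defines "B \<equiv> (\<lambda>n. nat \<bar>n\<bar>) ` (A - {0})"
  shows "finite B" "0 \<notin> B" "B \<noteq> {}" "card A \<le> 4 * card B" "card (B * B) \<le> card (A * A)"
proof -
  show fin: "finite B" "0 \<notin> B" using A by (auto simp: B_def)
  have "A - {0} \<subseteq> int ` B \<union> (\<lambda>b. - int b) ` B"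
  proof
    fix n assume "n \<in> A - {0}"
    then have "nat \<bar>n\<bar> \<in> B" by (auto simp: B_def)
    then have "int (nat \<bar>n\<bar>) \<in> int ` B" "- int (nat \<bar>n\<bar>) \<in> (\<lambda>b. - int b) ` B" by blast+
    then show "n \<in> int ` B \<union> (\<lambda>b. - int b) ` B" by (cases "n \<ge> 0") auto
  qed
  then have "card (A - {0}) \<le> card (int ` B \<union> (\<lambda>b. - int b) ` B)"
    using fin by (intro card_mono) auto
  also have "\<dots> \<le> card (int ` B) + card ((\<lambda>b. - int b) ` B)" by (rule card_Un_le)
  also have "\<dots> \<le> card B + card B" using fin by (intro add_mono card_image_le)
  finally have "card (A - {0}) \<le> 2 * card B" by simp
  moreover have "card A \<le> card (A - {0}) + 1" by (auto simp: card_Diff_singleton_if)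
  ultimately show *: "card A \<le> 4 * card B" using A by linarith
  show "B \<noteq> {}" using * A by auto
  have "B * B \<subseteq> (\<lambda>n. nat \<bar>n\<bar>) ` (A * A)"
  proof
    fix x assume "x \<in> B * B"
    then obtain a b where "a \<in> A" "b \<in> A" "x = nat \<bar>a\<bar> * nat \<bar>b\<bar>"
      unfolding set_times_def B_def by blast
    then show "x \<in> (\<lambda>n. nat \<bar>n\<bar>) ` (A * A)"
      by (intro image_eqI[of _ _ "a * b"]) (auto simp: abs_mult nat_mult_distrib intro: set_times_intro)
  qed
  then have "card (B * B) \<le> card ((\<lambda>n. nat \<bar>n\<bar>) ` (A * A))"
    using A by (intro card_mono finite_imageI finite_set_times)
  also have "\<dots> \<le> card (A * A)" using A by (intro card_image_le finite_set_times)
  finally show "card (B * B) \<le> card (A * A)" .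
qed

text \<open>The bound \<open>2|BB|/W\<close> for the squared norm and the density bound \<open>|B|/W \<le> \<kappa>\<^sup>1\<^sup>/\<^sup>e\<close>, where
  \<open>\<kappa> = |BB|/|B|\<close>, combine to \<open>2 \<kappa>\<^sup>1\<^sup>+\<^sup>1\<^sup>/\<^sup>e\<close>.\<close>

lemma moment_le_powr_doubling:
  "\<exists>C\<ge>1. \<exists>L\<ge>0. \<forall>A K c. finite A \<longrightarrow> card A \<ge> 2 \<longrightarrow> K > 1 \<longrightarrow> real (card (A * A)) < K * real (card A) \<longrightarrow>
     (\<Sum>n\<in>A. (c n)\<^sup>2) \<le> 1 \<longrightarrow> moment (Suc m) (trig_sum A c) \<le> (C * K powr L) ^ (2 * Suc m)"
proof -
  obtain D :: real where D: "D \<ge> 1" and query: "\<And>p w. prime p \<Longrightarrow> (\<And>j. dominating (Suc m) (w j)) \<Longrightarrow>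
      dominating (Suc m) (\<lambda>n. w (multiplicity p n) n / D)"
    by (rule exE[OF dominating_query[of m]], elim conjE, rule that, assumption, simp)
  \<comment> \<open>small enough that a query, which divides weights by \<open>D\<close>, changes the potential by a factor of at most \<open>5/4\<close>\<close>
  define e where "e = min (1/8) (ln (5/4) / (ln D + 1))"
  have lnD: "ln D \<ge> 0" using D by simp
  have e: "0 < e" "e \<le> 1/8" using lnD by (simp add: e_def, simp only: e_def min.cobounded1)
  have "e * ln D \<le> ln (5/4)"
  proof -
    have "e * ln D \<le> ln (5/4) / (ln D + 1) * (ln D + 1)"
      using lnD e by (intro mult_mono) (auto simp: e_def)
    then show ?thesis using lnD by simp
  qed
  then have "exp (e * ln D) \<le> exp (ln (5/4))" by (simp only: exp_le_cancel_iff)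
  also have "\<dots> = 5/4" by (rule exp_ln) simp
  finally have De: "D powr e \<le> 5/4" using D by (simp add: powr_def)
  define L where "L = 1 + 1 / e"
  have L: "L \<ge> 0" using e by (simp add: L_def)
  have main: "moment (Suc m) (trig_sum A c) \<le> (sqrt (8 * 4 powr L) * K powr (L / 2)) ^ (2 * Suc m)"
    if A: "finite A" "card A \<ge> 2" and K: "K > 1" "real (card (A * A)) < K * real (card A)"
      and c: "(\<Sum>n\<in>A. (c n)\<^sup>2) \<le> 1" for A K c
  proof -
    define S where "S = A - {0}"
    define B where "B = (\<lambda>n. nat \<bar>n\<bar>) ` S"
    have B: "finite B" "0 \<notin> B" "B \<noteq> {}" "card A \<le> 4 * card B" "card (B * B) \<le> card (A * A)"
      using abs_image_properties[OF A] by (auto simp: B_def S_def)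
    obtain ps where ps: "separates ps B" "\<And>p. p \<in> set ps \<Longrightarrow> prime p"
      using exists_separating_primes[OF B(1,2)] by blast
    define W \<kappa> where "W = query_weight D ps B" and "\<kappa> = real (card (B * B)) / real (card B)"
    have W: "W > 0" unfolding W_def by (rule query_weight_pos[OF B(1,3)])
    have cB: "real (card B) > 0" using B by (simp add: card_gt_0_iff)
    have "\<exists>w. dominating (Suc m) w \<and> (\<forall>b. w b \<ge> 0) \<and> (\<forall>b. b \<notin> B \<longrightarrow> w b = 0) \<and> sum w B = W"
      unfolding W_def by (rule query_weight_attained) (use D B ps query in auto)
    then obtain w where w: "dominating (Suc m) w" "\<And>b. w b \<ge> 0" "\<And>b. b \<notin> B \<Longrightarrow> w b = 0" "sum w B = W"
      by blast
    have "growth_potential e D ps B * growth_potential e D ps B \<le> (real (card (B * B)))\<^sup>2"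
      using D De by (intro product_set_growth e B ps) auto
    then have "growth_potential e D ps B \<le> real (card (B * B))"
      unfolding power2_eq_square[symmetric] by (rule power2_le_imp_le) simp
    then have "real (card B) powr (1 + e) * W powr (- e) / real (card B) \<le> \<kappa>"
      unfolding \<kappa>_def growth_potential_def W_def[symmetric] by (rule divide_right_mono) simp
    then have le\<kappa>: "(real (card B) / W) powr e \<le> \<kappa>"
      using cB W by (simp add: powr_add powr_divide powr_minus field_simps)
    have \<kappa>0: "\<kappa> > 0"
    proof -
      have "(real (card B) / W) powr e > 0" using cB W by simp
      then show ?thesis using le\<kappa> by linarith
    qed
    have "((real (card B) / W) powr e) powr (1 / e) \<le> \<kappa> powr (1 / e)"
      using le\<kappa> e by (intro powr_mono2) auto
    then have dens: "real (card B) / W \<le> \<kappa> powr (1 / e)"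
      using e cB W by (simp add: powr_powr)
    have "real (card (B * B)) / W = \<kappa> * (real (card B) / W)"
      using cB by (simp add: \<kappa>_def)
    also have "\<dots> \<le> \<kappa> * \<kappa> powr (1 / e)" using dens \<kappa>0 by (intro mult_left_mono) auto
    also have "\<dots> = \<kappa> powr L" using \<kappa>0 by (simp add: L_def powr_add)
    also have "\<kappa> \<le> 4 * K"
    proof -
      have "real (card (B * B)) \<le> K * real (card A)" using K B(5) by linarith
      also have "\<dots> \<le> K * (4 * real (card B))" using K B(4) by (intro mult_left_mono) auto
      finally show ?thesis using cB by (simp add: \<kappa>_def field_simps)
    qed
    then have "\<kappa> powr L \<le> (4 * K) powr L" using \<kappa>0 L by (intro powr_mono2) auto
    finally have BW: "real (card (B * B)) / W \<le> (4 * K) powr L" .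
    define y where "y = 2 * (4 * K) powr L"
    have "1 \<le> (4 * K) powr L" using K L by (intro ge_one_powr_ge_zero) auto
    then have y: "y \<ge> 1" by (simp add: y_def)
    have mS: "moment (Suc m) (trig_sum S c) \<le> sqrt y ^ (2 * Suc m)"
    proof -
      have cS: "(\<Sum>n\<in>S. (c n)\<^sup>2) \<le> 1"
        using c sum_mono2[of A S "\<lambda>n. (c n)\<^sup>2"] A by (auto simp: S_def)
      have "moment (Suc m) (trig_sum S c) \<le> (2 * real (card (B * B)) / sum w B) ^ Suc m"
        by (rule moment_le_of_dominating[OF w(1,2) _ B(1,2) _ _ _ cS w(3)])
           (use w(4) W A in \<open>auto simp: B_def S_def\<close>)
      also have "\<dots> \<le> y ^ Suc m"
        using BW W w(4) by (intro power_mono) (auto simp: y_def)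
      also have "\<dots> = sqrt y ^ (2 * Suc m)" using y by (simp add: power_mult del: power_Suc mult_Suc_right)
      finally show ?thesis .
    qed
    have m0: "moment (Suc m) (trig_sum (A \<inter> {0}) c) \<le> 1 ^ (2 * Suc m)"
    proof -
      have "real (card (A \<inter> {0})) \<le> 1" using card_mono[of "{0}" "A \<inter> {0}"] by simp
      then have "moment (Suc m) (trig_sum (A \<inter> {0}) c) \<le> (\<Sum>n\<in>A \<inter> {0}. 1 * (c n)\<^sup>2) ^ Suc m"
        using A by (intro moment_le_card) auto
      also have "(\<Sum>n\<in>A \<inter> {0}. 1 * (c n)\<^sup>2) \<le> 1"
        using c sum_mono2[of A "A \<inter> {0}" "\<lambda>n. (c n)\<^sup>2"] A by auto
      then have "(\<Sum>n\<in>A \<inter> {0}. 1 * (c n)\<^sup>2) ^ Suc m \<le> 1 ^ Suc m"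
        by (intro power_mono sum_nonneg) auto
      finally show ?thesis by simp
    qed
    have "moment (Suc m) (\<lambda>\<theta>. \<Sum>i\<in>(UNIV :: bool set). trig_sum (if i then S else A \<inter> {0}) c \<theta>)
        \<le> (\<Sum>i\<in>(UNIV :: bool set). if i then sqrt y else 1) ^ (2 * Suc m)"
      by (rule moment_sum_le) (use mS m0 y in \<open>auto intro: continuous_on_trig_sum simp del: power_Suc mult_Suc_right\<close>)
    also have "(\<lambda>\<theta>. \<Sum>i\<in>(UNIV :: bool set). trig_sum (if i then S else A \<inter> {0}) c \<theta>) = trig_sum A c"
    proof
      fix \<theta>
      have "A = S \<union> (A \<inter> {0})" by (auto simp: S_def)
      then have "trig_sum A c \<theta> = trig_sum (S \<union> (A \<inter> {0})) c \<theta>" by simp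
      also have "\<dots> = trig_sum S c \<theta> + trig_sum (A \<inter> {0}) c \<theta>"
        unfolding trig_sum_def using A by (intro sum.union_disjoint) (auto simp: S_def)
      finally show "(\<Sum>i\<in>(UNIV :: bool set). trig_sum (if i then S else A \<inter> {0}) c \<theta>) = trig_sum A c \<theta>"
        by (simp add: UNIV_bool)
    qed
    also have "(\<Sum>i\<in>(UNIV :: bool set). if i then sqrt y else 1) ^ (2 * Suc m) \<le> (2 * sqrt y) ^ (2 * Suc m)"
      using y by (intro power_mono) (auto simp: UNIV_bool)
    also have "2 * sqrt y = sqrt (8 * 4 powr L) * K powr (L / 2)"
    proof -
      have "2 * sqrt y = sqrt (4 * y)" by (simp add: real_sqrt_mult)
      also have "4 * y = 8 * 4 powr L * (K powr (L / 2))\<^sup>2"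
        using K by (simp add: y_def powr_mult power2_eq_square flip: powr_add)
      finally show ?thesis by (simp add: real_sqrt_mult)
    qed
    finally show ?thesis .
  qed
  have "1 \<le> (4::real) powr L" using L by (intro ge_one_powr_ge_zero) auto
  then have "sqrt (8 * 4 powr L) \<ge> 1" by simp
  then show ?thesis
    using L by (intro exI[of _ "sqrt (8 * 4 powr L)"] exI[of _ "L / 2"] conjI allI impI main) auto
qed

theorem proposition2:
  fixes \<gamma> q :: real
  assumes "\<gamma> > 0" and "q > 2"
  shows "\<exists>\<Lambda>::real. \<forall>(A::int set) (N::nat) (K::real).
           finite A \<longrightarrow> card A = N \<longrightarrow> real (card (A * A)) < K * real N \<longrightarrow>
           (card (A * A) = card A \<and> card A > 1 \<longrightarrow> K \<ge> 2) \<longrightarrow>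
           lambda_const q A < K powr \<Lambda> * real N powr \<gamma>"
proof -
  define m where "m = nat \<lceil>q\<rceil>"
  have "q \<le> real m" unfolding m_def by (rule real_nat_ceiling_ge)
  then have qm: "q \<le> 2 * real (Suc m)" by simp
  obtain C L where C: "C \<ge> 1" and L: "L \<ge> 0" and mom: "\<And>A K c. finite A \<Longrightarrow> card A \<ge> 2 \<Longrightarrow> K > 1 \<Longrightarrow>
     real (card (A * A)) < K * real (card A) \<Longrightarrow> (\<Sum>n\<in>A. (c n)\<^sup>2) \<le> 1 \<Longrightarrow>
     moment (Suc m) (trig_sum A c) \<le> (C * K powr L) ^ (2 * Suc m)"
    using moment_le_powr_doubling[of m] by metis
  \<comment> \<open>sets of size at least \<open>M\<close> absorb \<open>C\<close> in \<open>N\<^sup>\<gamma>\<close>; smaller ones have \<open>K \<ge> 1 + 1/M\<close> and absorb it in \<open>K\<^sup>t\<close>\<close>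
  define M where "M = nat \<lceil>C powr (1 / \<gamma>)\<rceil> + 2"
  have "C powr (1 / \<gamma>) \<le> real (nat \<lceil>C powr (1 / \<gamma>)\<rceil>)" by (rule real_nat_ceiling_ge)
  also have "\<dots> < real M" unfolding M_def by (simp only: of_nat_less_iff)
  finally have M: "C powr (1 / \<gamma>) < real M" .
  define t where "t = ln C / ln (1 + 1 / real M) + 1"
  have "M > 0" unfolding M_def by (rule trans_less_add2) simp
  then have M1: "1 + 1 / real M > 1" by simp
  then have ln0: "ln (1 + 1 / real M) > 0" by (rule ln_gt_zero)
  have t: "t \<ge> 1" using C ln0 by (simp add: t_def)
  have Ct: "C < (1 + 1 / real M) powr t"
  proof -
    have "ln C < t * ln (1 + 1 / real M)" using ln0 by (simp add: t_def field_simps)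
    then have "exp (ln C) < exp (t * ln (1 + 1 / real M))" by simp
    moreover have "1 + 1 / real M \<noteq> 0" using M1 by linarith
    ultimately show ?thesis using C by (simp add: powr_def)
  qed
  show ?thesis
  proof (intro exI[of _ "L + t"] allI impI)
    fix A :: "int set" and N :: nat and K :: real
    assume A: "finite A" and N: "card A = N" and K: "real (card (A * A)) < K * real N"
      and K2: "card (A * A) = card A \<and> card A > 1 \<longrightarrow> K \<ge> 2"
    obtain c where c: "sqrt (\<Sum>n\<in>A. (c n)\<^sup>2) \<le> 1" and lam: "lambda_const q A = circle_norm q (trig_sum A c)"
      using lambda_const_attained[OF A assms(2)] by blast
    have c1: "(\<Sum>n\<in>A. (c n)\<^sup>2) \<le> 1" using c by simp
    have bound: "lambda_const q A \<le> b" if "moment (Suc m) (trig_sum A c) \<le> b ^ (2 * Suc m)" "b > 0" for b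
      unfolding lam using that assms(2) qm by (intro circle_norm_le[where k = "Suc m"] continuous_on_trig_sum)
    have "N \<noteq> 0" using K by (cases "N = 0") simp_all
    then consider "N = 1" | "N \<ge> 2" by linarith
    then show "lambda_const q A < K powr (L + t) * real N powr \<gamma>"
    proof cases
      case 1
      then obtain a where a: "A = {a}" using N card_1_singletonE by blast
      then have "K > 1" using K 1 by (simp add: set_times_def)
      have "moment (Suc m) (trig_sum A c) \<le> (\<Sum>n\<in>A. 1 * (c n)\<^sup>2) ^ Suc m"
        using A N 1 by (intro moment_le_card) auto
      also have "\<dots> \<le> 1 ^ Suc m" using c1 by (intro power_mono sum_nonneg) auto
      finally have "lambda_const q A \<le> 1" by (intro bound) auto
      also have "1 < K powr (L + t)" using \<open>K > 1\<close> L t by (intro gr_one_powr) auto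
      finally show ?thesis using 1 by simp
    next
      case 2
      have "\<exists>a\<in>A. a \<noteq> 0"
      proof (rule ccontr)
        assume "\<not> ?thesis"
        then have "A \<subseteq> {0}" by auto
        then show False using card_mono[of "{0}" A] N 2 by simp
      qed
      then have cardle: "N \<le> card (A * A)" using card_le_card_times[OF A] N by blast
      have K1: "K \<ge> 1 + 1 / real N"
      proof (cases "card (A * A) = N")
        case True
        then have "K \<ge> 2" using K2 N 2 by auto
        moreover have "1 / real N \<le> 1" using 2 by simp
        ultimately show ?thesis by linarith
      next
        case False
        then have "real N + 1 < K * real N" using cardle K by linarith
        then show ?thesis using 2 by (simp add: field_simps)
      qed
      have K0: "K > 1"
      proof -
        have "1 / real N > 0" using 2 by simp
        then show ?thesis using K1 by linarith
      qed
      have Kt: "K powr L > 0" using K0 by simp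
      have "lambda_const q A \<le> C * K powr L"
        using A N 2 K K0 c1 C Kt by (intro bound mom) auto
      also have "\<dots> < K powr (L + t) * real N powr \<gamma>"
      proof (cases "N \<ge> M")
        case True
        have "C = (C powr (1 / \<gamma>)) powr \<gamma>" using C assms by (simp add: powr_powr)
        also have "\<dots> < real M powr \<gamma>" using M assms by (intro powr_less_mono2) auto
        also have "\<dots> \<le> real N powr \<gamma>" using True assms by (intro powr_mono2) auto
        finally have "C * K powr L < real N powr \<gamma> * K powr L" using Kt by simp
        also have "\<dots> \<le> real N powr \<gamma> * K powr (L + t)"
          using K0 t by (intro mult_left_mono powr_mono) auto
        finally show ?thesis by (simp add: mult.commute)
      next
        case False
        have "1 / real M \<le> 1 / real N" using False 2 by (intro divide_left_mono) auto
        then have "(1 + 1 / real M) powr t \<le> K powr t"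
          using K1 t by (intro powr_mono2) auto
        then have "C * K powr L < K powr t * K powr L" using Ct Kt by simp
        also have "\<dots> = K powr (L + t) * 1" by (simp add: powr_add)
        also have "\<dots> \<le> K powr (L + t) * real N powr \<gamma>"
          using 2 assms by (intro mult_left_mono ge_one_powr_ge_zero) auto
        finally show ?thesis .
      qed
      finally show ?thesis .
    qed
  qed
qed

end
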